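(* Let $p,q\ge 0$ be integers such that the real Clifford algebra $C\ell_{p,q}$ is simple (i.e. $p-q\not\equiv 1 \pmod 4$). Let $\mathbb{K}=fC\ell_{p,q}f$ for a primitive idempotent $f\in C\ell_{p,q}$, let $k=q-r_{q-p}$, where $r_i$ is the $i$-th Radon–Hurwitz number, and let $N=2^k$. Let $T_\varepsilon^{\sim}$ be the transposition anti-involution of $C\ell_{p,q}$ and let $$G_{p,q}^{\varepsilon}=\{g\in C\ell_{p,q}\mid T_\varepsilon^{\sim}(g)\,g=1\}.$$ Then $G_{p,q}^{\varepsilon}$ is, up to group isomorphism, the orthogonal group $O(N)$ when $\mathbb{K}\cong\mathbb{R}$, the complex unitary group $U(N)$ when $\mathbb{K}\cong\mathbb{C}$, and the compact symplectic group $Sp(N)=U_{\mathbb{H}}(N)$ when $\mathbb{K}\cong\mathbb{H}$. That is, $$G_{p,q}^{\varepsilon}\cong\begin{cases} O(N) & \text{if } p-q\equiv 0,1,2 \pmod 8,\\ U(N) & \text{if } p-q\equiv 3,7 \pmod 8,\\ Sp(N) & \text{if } p-q\equiv 4,5,6 \pmod 8.\end{cases}$$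
   Context: $C\ell_{p,q}$ is the universal Clifford algebra of the real quadratic space $(V,Q)$ of dimension $n=p+q$ with orthonormal basis $e_1,\dots,e_n$, where $e_i^2=Q(e_i)=\varepsilon_i$, with $\varepsilon_i=1$ for $1\le i\le p$ and $\varepsilon_i=-1$ for $p<i\le n$, and $e_ie_j=-e_je_i$ for $i\ne j$. (Since simplicity means $p-q\not\equiv 1\pmod 4$, the residues $1$ and $5$ modulo $8$ in the list of cases do not actually occur.) Transposition anti-involution: $t_\varepsilon:V\to V$ is the linear map with $t_\varepsilon(e_i)=\varepsilon_i e_i$ for all $i$. $T_\varepsilon^{\sim}:C\ell_{p,q}\to C\ell_{p,q}$ is the unique $\mathbb{R}$-linear algebra anti-involution (so $T_\varepsilon^{\sim}(uv)=T_\varepsilon^{\sim}(v)T_\varepsilon^{\sim}(u)$ and $T_\varepsilon^{\sim}(1)=1$) that restricts to $t_\varepsilon$ on $V$. Explicitly, for $i_1<\dots<i_m$, $$T_\varepsilon^{\sim}(e_{i_1}\cdots e_{i_m})=(-1)^{m(m-1)/2}\,t_\varepsilon(e_{i_1})\cdots t_\varepsilon(e_{i_m}).$$ Radon–Hurwitz numbers: $r_i$ for $i\in\mathbb{Z}$ is defined by $r_0=0$, $r_1=1$, $r_2=r_3=2$, $r_4=r_5=r_6=r_7=3$, and $r_{i+8}=r_i+4$ for all $i\in\mathbb{Z}$ (so, for example, $r_{-1}=-1$). Groups: $O(N)=\{A\in \mathrm{Mat}(N,\mathbb{R})\mid A^TA=1\}$; $U(N)=\{A\in\mathrm{Mat}(N,\mathbb{C})\mid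 A^\dagger A=1\}$ with $\dagger$ the complex conjugate transpose; $Sp(N)=U_{\mathbb{H}}(N)=\{A\in\mathrm{Mat}(N,\mathbb{H})\mid A^\ddagger A=1\}$ with $\ddagger$ the quaternionic conjugate transpose. *)

theory Defs
  imports
    "HOL-Algebra.Algebraic_Closure_Type"
    "HOL-Algebra.QuotRing"
    "HOL-Algebra.Module"
    "Jordan_Normal_Form.Matrix"
begin

section \<open>The Clifford algebra of signature (p, q)\<close>

text \<open>
  An element is its family of coefficients with respect to the basis
  \<open>e_A = e_i1 \<cdots> e_im\<close>, where \<open>A = {i1 < \<dots> < im}\<close> ranges over the subsets of
  \<open>{1..p+q}\<close>. The relations between the generators force
  \<open>e_A e_B = \<sigma>(A,B) e_(A \<Delta> B)\<close>: moving the factors of \<open>e_B\<close> into place, a pair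
  \<open>a \<in> A\<close>, \<open>b \<in> B\<close> contributes \<open>-1\<close> if \<open>b < a\<close>, the square \<open>\<epsilon>_a\<close> if \<open>a = b\<close>, and \<open>1\<close>
  otherwise. In the product below, \<open>B = A \<Delta> C\<close> is the only \<open>B\<close> for which \<open>e_A e_B\<close>
  contributes to the coefficient of \<open>e_C\<close>.
\<close>

definition eps :: "nat \<Rightarrow> nat \<Rightarrow> real" where
  "eps p i = (if i \<le> p then 1 else -1)"

definition clifford_sign :: "nat \<Rightarrow> nat set \<Rightarrow> nat set \<Rightarrow> real" where
  "clifford_sign p A B =
     (\<Prod>a\<in>A. \<Prod>b\<in>B. if b < a then -1 else if a = b then eps p a else 1)"

definition clifford_basis :: "nat set \<Rightarrow> nat set \<Rightarrow> real" where
  "clifford_basis A = (\<lambda>B. if B = A then 1 else 0)"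

definition clifford_gen :: "nat \<Rightarrow> nat set \<Rightarrow> real" where
  "clifford_gen i = clifford_basis {i}"

definition clifford :: "nat \<Rightarrow> nat \<Rightarrow> (real, nat set \<Rightarrow> real) module" where
  "clifford p q =
     \<lparr> carrier = {x. \<forall>A. x A \<noteq> 0 \<longrightarrow> A \<subseteq> {1..p+q}},
       monoid.mult = (\<lambda>x y C. \<Sum>A\<in>Pow {1..p+q}.
          clifford_sign p A (sym_diff A C) * x A * y (sym_diff A C)),
       one = clifford_basis {},
       ring.zero = (\<lambda>_. 0),
       add = (\<lambda>x y A. x A + y A),
       module.smult = (\<lambda>c x A. c * x A) \<rparr>"

text \<open>
  The transposition anti-involution is the linear extension of
  \<open>e_A \<mapsto> (-1)^(m(m-1)/2) t(e_i1) \<cdots> t(e_im)\<close>, where \<open>t(e_i) = \<epsilon>_i e_i\<close>. It is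
  characterised as an anti-involution in the lemmas \<open>transposition_anti_involution\<close>
  and \<open>transposition_unique\<close> below.
\<close>

definition transposition :: "nat \<Rightarrow> nat \<Rightarrow> (nat set \<Rightarrow> real) \<Rightarrow> (nat set \<Rightarrow> real)" where
  "transposition p q x =
     (\<lambda>A. (-1) ^ (card A * (card A - 1) div 2) * (\<Prod>i\<in>A. eps p i) * x A)"

definition transposition_group :: "nat \<Rightarrow> nat \<Rightarrow> (nat set \<Rightarrow> real) monoid" where
  "transposition_group p q =
     \<lparr> carrier = {g \<in> carrier (clifford p q).
          transposition p q g \<otimes>\<^bsub>clifford p q\<^esub> g = \<one>\<^bsub>clifford p q\<^esub>},
       monoid.mult = monoid.mult (clifford p q),
       one = \<one>\<^bsub>clifford p q\<^esub> \<rparr>"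


section \<open>Simple rings, primitive idempotents, corner rings\<close>

definition simple_ring :: "('a, 'm) ring_scheme \<Rightarrow> bool" where
  "simple_ring R \<longleftrightarrow> ring R \<and> \<one>\<^bsub>R\<^esub> \<noteq> \<zero>\<^bsub>R\<^esub> \<and>
     (\<forall>I. ideal I R \<longrightarrow> I = {\<zero>\<^bsub>R\<^esub>} \<or> I = carrier R)"

definition idempotent_element :: "('a, 'm) ring_scheme \<Rightarrow> 'a \<Rightarrow> bool" where
  "idempotent_element R f \<longleftrightarrow> f \<in> carrier R \<and> f \<otimes>\<^bsub>R\<^esub> f = f"

definition primitive_idempotent :: "('a, 'm) ring_scheme \<Rightarrow> 'a \<Rightarrow> bool" where
  "primitive_idempotent R f \<longleftrightarrow> idempotent_element R f \<and> f \<noteq> \<zero>\<^bsub>R\<^esub> \<and>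
     \<not> (\<exists>g h. idempotent_element R g \<and> idempotent_element R h \<and>
          g \<noteq> \<zero>\<^bsub>R\<^esub> \<and> h \<noteq> \<zero>\<^bsub>R\<^esub> \<and>
          g \<otimes>\<^bsub>R\<^esub> h = \<zero>\<^bsub>R\<^esub> \<and> h \<otimes>\<^bsub>R\<^esub> g = \<zero>\<^bsub>R\<^esub> \<and> f = g \<oplus>\<^bsub>R\<^esub> h)"

definition corner_ring :: "('a, 'm) ring_scheme \<Rightarrow> 'a \<Rightarrow> ('a, 'm) ring_scheme" where
  "corner_ring R f =
     R \<lparr> carrier := {f \<otimes>\<^bsub>R\<^esub> x \<otimes>\<^bsub>R\<^esub> f | x. x \<in> carrier R}, one := f \<rparr>"


section \<open>Radon--Hurwitz numbers\<close>

definition radon_hurwitz :: "int \<Rightarrow> int" where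
  "radon_hurwitz i = 4 * (i div 8) + [0, 1, 2, 2, 3, 3, 3, 3] ! nat (i mod 8)"

lemma radon_hurwitz_initial:
  "radon_hurwitz 0 = 0" "radon_hurwitz 1 = 1" "radon_hurwitz 2 = 2" "radon_hurwitz 3 = 2"
  "radon_hurwitz 4 = 3" "radon_hurwitz 5 = 3" "radon_hurwitz 6 = 3" "radon_hurwitz 7 = 3"
  by (simp_all add: radon_hurwitz_def eval_nat_numeral)

lemma radon_hurwitz_periodic: "radon_hurwitz (i + 8) = radon_hurwitz i + 4"
  by (simp add: radon_hurwitz_def)

lemma radon_hurwitz_le: "radon_hurwitz (int q - int p) \<le> int q"
proof -
  define i where "i = int q - int p"
  have "i mod 8 \<in> {0, 1, 2, 3, 4, 5, 6, 7}"
    by auto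
  hence "radon_hurwitz i \<le> 4 * (i div 8) + i mod 8 \<and> radon_hurwitz i \<le> 4 * (i div 8) + 3"
    by (auto simp: radon_hurwitz_def eval_nat_numeral)
  moreover have "i = 8 * (i div 8) + i mod 8" "i \<le> int q" "0 \<le> i mod 8"
    by (simp_all add: i_def)
  ultimately show ?thesis unfolding i_def[symmetric] by (cases "i div 8 \<ge> 0") linarith+
qed


section \<open>Quaternions; the rings R, C and H\<close>

datatype quat = Quat (qr: real) (qi: real) (qj: real) (qk: real)

lemma quat_eq_iff: "x = y \<longleftrightarrow> qr x = qr y \<and> qi x = qi y \<and> qj x = qj y \<and> qk x = qk y"
  by (auto intro: quat.expand)

instantiation quat :: ring_1
begin

definition "0 = Quat 0 0 0 0"
definition "1 = Quat 1 0 0 0"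
definition "x + y = Quat (qr x + qr y) (qi x + qi y) (qj x + qj y) (qk x + qk y)"
definition "- x = Quat (- qr x) (- qi x) (- qj x) (- qk x)"
definition "x - y = Quat (qr x - qr y) (qi x - qi y) (qj x - qj y) (qk x - qk y)"
definition "x * y = Quat
  (qr x * qr y - qi x * qi y - qj x * qj y - qk x * qk y)
  (qr x * qi y + qi x * qr y + qj x * qk y - qk x * qj y)
  (qr x * qj y - qi x * qk y + qj x * qr y + qk x * qi y)
  (qr x * qk y + qi x * qj y - qj x * qi y + qk x * qr y)"

instance
  by standard
    (simp_all add: quat_eq_iff zero_quat_def one_quat_def plus_quat_def uminus_quat_def
      minus_quat_def times_quat_def algebra_simps)

end

definition real_ring :: "real ring" where "real_ring = ring_of_type_algebra"
definition complex_ring :: "complex ring" where "complex_ring = ring_of_type_algebra"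
definition quat_ring :: "quat ring" where "quat_ring = ring_of_type_algebra"

definition qcnj :: "quat \<Rightarrow> quat" where
  "qcnj x = Quat (qr x) (- qi x) (- qj x) (- qk x)"


section \<open>The compact classical groups\<close>

definition orthogonal_group :: "nat \<Rightarrow> real mat monoid" where
  "orthogonal_group N =
     \<lparr> carrier = {A \<in> carrier_mat N N. transpose_mat A * A = 1\<^sub>m N},
       monoid.mult = (*), one = 1\<^sub>m N \<rparr>"

definition unitary_group :: "nat \<Rightarrow> complex mat monoid" where
  "unitary_group N =
     \<lparr> carrier = {A \<in> carrier_mat N N. map_mat cnj (transpose_mat A) * A = 1\<^sub>m N},
       monoid.mult = (*), one = 1\<^sub>m N \<rparr>"

definition symplectic_group :: "nat \<Rightarrow> quat mat monoid" where
  "symplectic_group N =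
     \<lparr> carrier = {A \<in> carrier_mat N N. map_mat qcnj (transpose_mat A) * A = 1\<^sub>m N},
       monoid.mult = (*), one = 1\<^sub>m N \<rparr>"


section \<open>The construction is the universal Clifford algebra\<close>

lemma clifford_simps:
  "carrier (clifford p q) = {x. \<forall>A. x A \<noteq> 0 \<longrightarrow> A \<subseteq> {1..p+q}}"
  "x \<otimes>\<^bsub>clifford p q\<^esub> y = (\<lambda>C. \<Sum>A\<in>Pow {1..p+q}.
      clifford_sign p A (sym_diff A C) * x A * y (sym_diff A C))"
  "\<one>\<^bsub>clifford p q\<^esub> = clifford_basis {}"
  "\<zero>\<^bsub>clifford p q\<^esub> = (\<lambda>_. 0)"
  "x \<oplus>\<^bsub>clifford p q\<^esub> y = (\<lambda>A. x A + y A)"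
  "c \<odot>\<^bsub>clifford p q\<^esub> x = (\<lambda>A. c * x A)"
  by (simp_all add: clifford_def)

lemma sign_square_prod_sym_diff:
  fixes f :: "nat \<Rightarrow> real"
  assumes "finite A" "finite B" "\<And>i. f i * f i = 1"
  shows "prod f (sym_diff A B) = prod f A * prod f B"
proof -
  have "prod f A = prod f (A - B) * prod f (A \<inter> B)"
    using assms by (metis Int_Diff_disjoint Int_Diff_Un finite_Diff finite_Int inf_commute
        prod.union_disjoint mult.commute)
  moreover have "prod f B = prod f (B - A) * prod f (A \<inter> B)"
    using assms by (metis Int_Diff_disjoint Int_Diff_Un finite_Diff finite_Int inf_commute
        prod.union_disjoint mult.commute)
  moreover have "prod f (A \<inter> B) * prod f (A \<inter> B) = 1"
    by (simp add: prod.distrib[symmetric] assms(3))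
  moreover have "prod f (sym_diff A B) = prod f (A - B) * prod f (B - A)"
    using assms by (intro prod.union_disjoint) auto
  ultimately show ?thesis by (simp add: mult_ac)
qed

lemma eps_square [simp]: "eps p i * eps p i = 1"
  by (simp add: eps_def)

lemma clifford_sign_square: "clifford_sign p A B * clifford_sign p A B = 1"
  by (auto simp: clifford_sign_def prod.distrib[symmetric] intro!: prod.neutral)

lemma clifford_sign_sym_diff_left:
  assumes "finite A" "finite B"
  shows "clifford_sign p (sym_diff A B) C = clifford_sign p A C * clifford_sign p B C"
  unfolding clifford_sign_def
  by (rule sign_square_prod_sym_diff[OF assms])
    (auto simp: prod.distrib[symmetric] intro!: prod.neutral)

lemma clifford_sign_swap:
  "clifford_sign p A B = (\<Prod>b\<in>B. \<Prod>a\<in>A. if b < a then -1 else if a = b then eps p a else 1)"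
  unfolding clifford_sign_def by (rule prod.swap)

lemma clifford_sign_sym_diff_right:
  assumes "finite A" "finite B"
  shows "clifford_sign p C (sym_diff A B) = clifford_sign p C A * clifford_sign p C B"
  unfolding clifford_sign_swap
  by (rule sign_square_prod_sym_diff[OF assms])
    (auto simp: prod.distrib[symmetric] intro!: prod.neutral)

lemma clifford_sign_empty [simp]: "clifford_sign p {} B = 1" "clifford_sign p A {} = 1"
  by (simp_all add: clifford_sign_def)

lemma sym_diff_cancel: "sym_diff A (sym_diff A B) = B"
  by auto

lemma sym_diff_subset_iff: "A \<subseteq> S \<Longrightarrow> sym_diff A B \<subseteq> S \<longleftrightarrow> B \<subseteq> S"
  by auto

lemma clifford_mult_closed:
  assumes "x \<in> carrier (clifford p q)" "y \<in> carrier (clifford p q)"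
  shows "x \<otimes>\<^bsub>clifford p q\<^esub> y \<in> carrier (clifford p q)"
proof -
  have "C \<subseteq> {1..p+q}"
    if nz: "(\<Sum>A\<in>Pow {1..p+q}. clifford_sign p A (sym_diff A C) * x A * y (sym_diff A C)) \<noteq> 0" for C
  proof -
    obtain A where "A \<in> Pow {1..p+q}" "y (sym_diff A C) \<noteq> 0"
      using sum.not_neutral_contains_not_neutral[OF nz] by (metis mult_zero_right)
    thus ?thesis using assms(2) sym_diff_subset_iff[of A "{1..p+q}" C]
      by (auto simp: clifford_simps)
  qed
  thus ?thesis by (simp add: clifford_simps)
qed

lemma sum_Pow_sym_diff:
  fixes g :: "nat set \<Rightarrow> 'b::comm_monoid_add"
  assumes "A \<subseteq> S"
  shows "(\<Sum>B\<in>Pow S. g (sym_diff A B)) = (\<Sum>B\<in>Pow S. g B)"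
  by (rule sum.reindex_bij_witness[where i = "sym_diff A" and j = "sym_diff A"])
    (use assms in \<open>auto simp: sym_diff_cancel sym_diff_subset_iff\<close>)

lemma clifford_mult_assoc:
  assumes z: "z \<in> carrier (clifford p q)"
  shows "(x \<otimes>\<^bsub>clifford p q\<^esub> y) \<otimes>\<^bsub>clifford p q\<^esub> z = x \<otimes>\<^bsub>clifford p q\<^esub> (y \<otimes>\<^bsub>clifford p q\<^esub> z)"
proof
  fix D
  let ?I = "{1..p+q}" and ?s = "clifford_sign p"
  define s where "s = ?s"
  define g where "g B A' = s B (sym_diff B D) * s A' (sym_diff A' (sym_diff B D)) *
      x B * y A' * z (sym_diff A' (sym_diff B D))" for B A'
  have "((x \<otimes>\<^bsub>clifford p q\<^esub> y) \<otimes>\<^bsub>clifford p q\<^esub> z) D =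
     (\<Sum>A\<in>Pow ?I. \<Sum>B\<in>Pow ?I. s A (sym_diff A D) * s B (sym_diff B A) *
        x B * y (sym_diff B A) * z (sym_diff A D))"
    by (simp add: clifford_simps sum_distrib_left sum_distrib_right mult_ac s_def)
  also have "\<dots> = (\<Sum>B\<in>Pow ?I. \<Sum>A\<in>Pow ?I. s A (sym_diff A D) * s B (sym_diff B A) *
        x B * y (sym_diff B A) * z (sym_diff A D))"
    by (rule sum.swap)
  also have "\<dots> = (\<Sum>B\<in>Pow ?I. \<Sum>A\<in>Pow ?I. g B (sym_diff B A))"
  proof (intro sum.cong refl)
    fix A B assume AB: "B \<in> Pow ?I" "A \<in> Pow ?I"
    hence fin: "finite A" "finite B" by (auto intro: finite_subset)
    have eq: "sym_diff (sym_diff B A) (sym_diff B D) = sym_diff A D" by auto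
    have 1: "s (sym_diff B A) (sym_diff A D) = s B (sym_diff A D) * s A (sym_diff A D)"
      unfolding s_def by (rule clifford_sign_sym_diff_left[OF fin(2,1)])
    have "s B (sym_diff B D) = s B (sym_diff (sym_diff B A) (sym_diff A D))"
      by (rule arg_cong[of _ _ "s B"]) auto
    also have "\<dots> = s B (sym_diff B A) * s B (sym_diff A D)" if "finite D"
      unfolding s_def using fin that by (intro clifford_sign_sym_diff_right) auto
    finally have 2: "s B (sym_diff B D) = s B (sym_diff B A) * s B (sym_diff A D)" if "finite D"
      using that by blast
    have 3: "s B (sym_diff A D) * s B (sym_diff A D) = 1"
      unfolding s_def by (rule clifford_sign_square)
    have key: "finite D \<Longrightarrow> s A (sym_diff A D) * s B (sym_diff B A) =
        s B (sym_diff B D) * s (sym_diff B A) (sym_diff A D)"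
    proof -
      assume "finite D"
      have "s B (sym_diff B D) * s (sym_diff B A) (sym_diff A D) =
         s B (sym_diff B A) * s A (sym_diff A D) * (s B (sym_diff A D) * s B (sym_diff A D))"
        unfolding 1 2[OF \<open>finite D\<close>] by (simp only: mult_ac)
      thus ?thesis by (simp only: 3 mult_1_right mult_ac)
    qed
    show "s A (sym_diff A D) * s B (sym_diff B A) * x B * y (sym_diff B A) * z (sym_diff A D)
        = g B (sym_diff B A)"
    proof (cases "finite D")
      case True
      show ?thesis unfolding g_def eq key[OF True] by (simp only: mult_ac)
    next
      case False
      have "D \<subseteq> A \<union> sym_diff A D" by blast
      hence "infinite (sym_diff A D)" using False fin finite_subset by blast
      hence "\<not> sym_diff A D \<subseteq> ?I" using finite_subset by blast
      hence "z (sym_diff A D) = 0" using z unfolding clifford_simps(1) by blast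
      thus ?thesis unfolding g_def eq by simp
    qed
  qed
  also have "\<dots> = (\<Sum>B\<in>Pow ?I. \<Sum>A\<in>Pow ?I. g B A)"
    by (intro sum.cong refl sum_Pow_sym_diff) auto
  also have "\<dots> = (x \<otimes>\<^bsub>clifford p q\<^esub> (y \<otimes>\<^bsub>clifford p q\<^esub> z)) D"
    by (simp add: clifford_simps sum_distrib_left mult_ac s_def g_def)
  finally show "((x \<otimes>\<^bsub>clifford p q\<^esub> y) \<otimes>\<^bsub>clifford p q\<^esub> z) D =
    (x \<otimes>\<^bsub>clifford p q\<^esub> (y \<otimes>\<^bsub>clifford p q\<^esub> z)) D" .
qed

lemma clifford_one_mult:
  "clifford_basis {} \<otimes>\<^bsub>clifford p q\<^esub> x = x"
  by (rule ext) (simp add: clifford_simps clifford_basis_def if_distrib[of "\<lambda>t. _ * t * _"] 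
      sum.delta cong: if_cong)

lemma clifford_basis_mult_right:
  assumes B: "B \<subseteq> {1..p+q}" and x: "x \<in> carrier (clifford p q)"
  shows "x \<otimes>\<^bsub>clifford p q\<^esub> clifford_basis B =
    (\<lambda>C. clifford_sign p (sym_diff B C) B * x (sym_diff B C))"
proof
  fix C
  have eq: "sym_diff A C = B \<longleftrightarrow> A = sym_diff B C" for A by blast
  have "(x \<otimes>\<^bsub>clifford p q\<^esub> clifford_basis B) C =
    (\<Sum>A\<in>Pow {1..p+q}. if A = sym_diff B C then clifford_sign p A B * x A else 0)"
    unfolding clifford_simps clifford_basis_def
  proof (rule sum.cong[OF refl])
    fix A
    show "clifford_sign p A (sym_diff A C) * x A * (if sym_diff A C = B then 1 else 0) =
        (if A = sym_diff B C then clifford_sign p A B * x A else 0)"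
    proof (cases "A = sym_diff B C")
      case True
      hence "sym_diff A C = B" by (simp only: eq)
      thus ?thesis by (simp only: True[symmetric] refl if_True mult_1_right)
    next
      case False
      thus ?thesis by (simp only: eq if_False mult_zero_right)
    qed
  qed
  also have "\<dots> = clifford_sign p (sym_diff B C) B * x (sym_diff B C)"
    using x by (subst sum.delta) (auto simp: clifford_simps)
  finally show "(x \<otimes>\<^bsub>clifford p q\<^esub> clifford_basis B) C =
    clifford_sign p (sym_diff B C) B * x (sym_diff B C)" .
qed

lemma clifford_basis_closed:
  "A \<subseteq> {1..p+q} \<Longrightarrow> clifford_basis A \<in> carrier (clifford p q)"
  by (simp add: clifford_simps clifford_basis_def)

lemma clifford_basis_mult:
  assumes "A \<subseteq> {1..p+q}" "B \<subseteq> {1..p+q}"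
  shows "clifford_basis A \<otimes>\<^bsub>clifford p q\<^esub> clifford_basis B =
    clifford_sign p A B \<odot>\<^bsub>clifford p q\<^esub> clifford_basis (sym_diff A B)"
proof -
  have "clifford_sign p (sym_diff B C) B * clifford_basis A (sym_diff B C) =
      clifford_sign p A B * clifford_basis (sym_diff A B) C" for C
  proof -
    have "sym_diff B C = A \<longleftrightarrow> C = sym_diff A B" by blast
    thus ?thesis by (cases "sym_diff B C = A") (simp_all only: clifford_basis_def if_True if_False)
  qed
  thus ?thesis
    unfolding clifford_basis_mult_right[OF assms(2) clifford_basis_closed[OF assms(1)]]
      clifford_simps(6) by (rule ext)
qed

lemma clifford_add_closed:
  assumes "x \<in> carrier (clifford p q)" "y \<in> carrier (clifford p q)"
  shows "x \<oplus>\<^bsub>clifford p q\<^esub> y \<in> carrier (clifford p q)"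
proof -
  have "A \<subseteq> {1..p+q}" if "x A + y A \<noteq> 0" for A
  proof -
    have "x A \<noteq> 0 \<or> y A \<noteq> 0" using that by auto
    thus ?thesis using assms unfolding clifford_simps(1) by blast
  qed
  thus ?thesis by (simp add: clifford_simps)
qed

lemma clifford_ring: "ring (clifford p q)"
proof (rule ringI)
  show "abelian_group (clifford p q)"
  proof (rule abelian_groupI)
    show "\<exists>y\<in>carrier (clifford p q). y \<oplus>\<^bsub>clifford p q\<^esub> x = \<zero>\<^bsub>clifford p q\<^esub>"
      if "x \<in> carrier (clifford p q)" for x
      using that by (intro bexI[of _ "\<lambda>A. - x A"]) (auto simp: clifford_simps)
    show "x \<oplus>\<^bsub>clifford p q\<^esub> y \<in> carrier (clifford p q)"
      if "x \<in> carrier (clifford p q)" "y \<in> carrier (clifford p q)" for x y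
      using that by (rule clifford_add_closed)
  qed (auto simp: clifford_simps algebra_simps)
  show "monoid (clifford p q)"
  proof (rule monoidI)
    show "x \<otimes>\<^bsub>clifford p q\<^esub> \<one>\<^bsub>clifford p q\<^esub> = x" if "x \<in> carrier (clifford p q)" for x
      using clifford_basis_mult_right[OF _ that, of "{}"] by (simp add: clifford_simps(3))
  qed (auto simp: clifford_mult_closed clifford_mult_assoc clifford_simps(3)
      clifford_basis_closed clifford_one_mult)
qed (auto simp: clifford_simps algebra_simps sum.distrib)

lemma clifford_module:
  "module (ring_of_type_algebra :: real ring) (clifford p q)"
  by (rule moduleI[OF cring_from_type_algebra ring.is_abelian_group[OF clifford_ring]])
    (auto simp: clifford_simps ring_of_type_algebra_def algebra_simps)

lemma clifford_smult_mult:
  "(c \<odot>\<^bsub>clifford p q\<^esub> x) \<otimes>\<^bsub>clifford p q\<^esub> y = c \<odot>\<^bsub>clifford p q\<^esub> (x \<otimes>\<^bsub>clifford p q\<^esub> y)"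
  "x \<otimes>\<^bsub>clifford p q\<^esub> (c \<odot>\<^bsub>clifford p q\<^esub> y) = c \<odot>\<^bsub>clifford p q\<^esub> (x \<otimes>\<^bsub>clifford p q\<^esub> y)"
  by (simp_all add: clifford_simps sum_distrib_left mult_ac)

lemma clifford_gen_closed:
  "i \<in> {1..p+q} \<Longrightarrow> clifford_gen i \<in> carrier (clifford p q)"
  by (simp add: clifford_gen_def clifford_basis_closed)

lemma clifford_gen_square:
  assumes "i \<in> {1..p+q}"
  shows "clifford_gen i \<otimes>\<^bsub>clifford p q\<^esub> clifford_gen i =
    eps p i \<odot>\<^bsub>clifford p q\<^esub> \<one>\<^bsub>clifford p q\<^esub>"
proof -
  have "clifford_sign p {i} {i} = eps p i" by (simp add: clifford_sign_def)
  thus ?thesis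
    using assms clifford_basis_mult[of "{i}" p q "{i}"]
    by (simp add: clifford_gen_def clifford_simps(3))
qed

lemma clifford_gen_anticommute:
  assumes "i \<in> {1..p+q}" "j \<in> {1..p+q}" "i \<noteq> j"
  shows "clifford_gen i \<otimes>\<^bsub>clifford p q\<^esub> clifford_gen j =
    (-1) \<odot>\<^bsub>clifford p q\<^esub> (clifford_gen j \<otimes>\<^bsub>clifford p q\<^esub> clifford_gen i)"
proof -
  have "clifford_sign p {i} {j} = - clifford_sign p {j} {i}"
    using assms(3) by (simp add: clifford_sign_def)
  moreover have "sym_diff {i} {j} = sym_diff {j} {i}" by blast
  ultimately show ?thesis
    using assms clifford_basis_mult[of "{i}" p q "{j}"] clifford_basis_mult[of "{j}" p q "{i}"]
    by (simp add: clifford_gen_def clifford_simps(6))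
qed

lemma clifford_basis_insert:
  assumes "insert a A \<subseteq> {1..p+q}" "\<forall>b\<in>A. a < b"
  shows "clifford_basis (insert a A) =
    clifford_gen a \<otimes>\<^bsub>clifford p q\<^esub> clifford_basis A"
proof -
  have "clifford_sign p {a} A = 1"
    using assms(2) by (auto simp: clifford_sign_def intro!: prod.neutral)
  moreover have "sym_diff {a} A = insert a A"
    using assms(2) by auto
  ultimately show ?thesis
    using assms(1) by (simp add: clifford_gen_def clifford_basis_mult clifford_simps(6))
qed

lemma clifford_induct [consumes 1, case_names zero add]:
  assumes "x \<in> carrier (clifford p q)"
    and zero: "P \<zero>\<^bsub>clifford p q\<^esub>"
    and add: "\<And>c A x. A \<subseteq> {1..p+q} \<Longrightarrow> x \<in> carrier (clifford p q) \<Longrightarrow> P x \<Longrightarrow>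
      P ((c \<odot>\<^bsub>clifford p q\<^esub> clifford_basis A) \<oplus>\<^bsub>clifford p q\<^esub> x)"
  shows "P x"
proof -
  have "P x" if "finite S" "S \<subseteq> Pow {1..p+q}" "\<And>A. x A \<noteq> 0 \<Longrightarrow> A \<in> S" for S x
    using that
  proof (induction S arbitrary: x rule: finite_induct)
    case empty
    hence "x = \<zero>\<^bsub>clifford p q\<^esub>" by (auto simp: clifford_simps)
    thus ?case using zero by simp
  next
    case (insert A S)
    define y where "y = x(A := 0)"
    have "P y" using insert.prems by (intro insert.IH) (auto simp: y_def split: if_splits)
    moreover have "y \<in> carrier (clifford p q)"
      using insert.prems by (auto simp: y_def clifford_simps)
    moreover have "x = (x A \<odot>\<^bsub>clifford p q\<^esub> clifford_basis A) \<oplus>\<^bsub>clifford p q\<^esub> y"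
      by (auto simp: y_def clifford_simps clifford_basis_def)
    ultimately show ?case using add[of A y "x A"] insert.prems by auto
  qed
  from this[of "Pow {1..p+q}" x] assms(1) show ?thesis
    by (auto simp: clifford_simps)
qed

definition clifford_hom ::
  "nat \<Rightarrow> nat \<Rightarrow> ((nat set \<Rightarrow> real) \<Rightarrow> 'b::real_algebra_1) \<Rightarrow> bool" where
  "clifford_hom p q \<phi> \<longleftrightarrow> \<phi> \<one>\<^bsub>clifford p q\<^esub> = 1 \<and>
    (\<forall>x\<in>carrier (clifford p q). \<forall>y\<in>carrier (clifford p q).
       \<phi> (x \<oplus>\<^bsub>clifford p q\<^esub> y) = \<phi> x + \<phi> y \<and> \<phi> (x \<otimes>\<^bsub>clifford p q\<^esub> y) = \<phi> x * \<phi> y) \<and>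
    (\<forall>c. \<forall>x\<in>carrier (clifford p q). \<phi> (c \<odot>\<^bsub>clifford p q\<^esub> x) = c *\<^sub>R \<phi> x)"

theorem clifford_universal:
  fixes v :: "nat \<Rightarrow> 'b::real_algebra_1"
  assumes square: "\<And>i. i \<in> {1..p+q} \<Longrightarrow> v i * v i = of_real (eps p i)"
    and anticomm: "\<And>i j. i \<in> {1..p+q} \<Longrightarrow> j \<in> {1..p+q} \<Longrightarrow> i \<noteq> j \<Longrightarrow> v i * v j = - (v j * v i)"
  shows "\<exists>\<phi>. clifford_hom p q \<phi> \<and> (\<forall>i\<in>{1..p+q}. \<phi> (clifford_gen i) = v i)"
proof -
  let ?I = "{1..p+q}"
  define P where "P A = prod_list (map v (sorted_list_of_set A))" for A
  have P_empty: "P {} = 1" by (simp add: P_def)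
  have P_insert: "P (insert a A) = v a * P A" if "finite A" "\<forall>b\<in>A. a < b" for a A
  proof -
    have "a \<notin> A" using that by auto
    hence "sorted_list_of_set (insert a A) = insort a (sorted_list_of_set A)"
      using that by simp
    also have "\<dots> = a # sorted_list_of_set A"
      using that by (intro insort_is_Cons) auto
    finally show ?thesis by (simp add: P_def)
  qed
  have gen: "v m * P B = clifford_sign p {m} B *\<^sub>R P (sym_diff {m} B)"
    if "finite B" "m \<in> ?I" "B \<subseteq> ?I" for m B
    using that
  proof (induction B rule: finite_linorder_min_induct)
    case empty
    thus ?case by (simp add: P_empty P_insert)
  next
    case (insert b B)
    have B: "finite B" "\<forall>c\<in>B. b < c" "b \<notin> B" using insert.hyps by auto
    consider "m < b" | "m = b" | "b < m" by linarith
    thus ?case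
    proof cases
      case 1
      hence lt: "\<forall>c\<in>insert b B. m < c" using B by auto
      hence "clifford_sign p {m} (insert b B) = 1"
        by (auto simp: clifford_sign_def intro!: prod.neutral)
      moreover have "sym_diff {m} (insert b B) = insert m (insert b B)" using lt by auto
      moreover have "P (insert m (insert b B)) = v m * P (insert b B)"
        using P_insert[OF _ lt] B(1) by simp
      ultimately show ?thesis by simp
    next
      case 2
      have "clifford_sign p {m} B = 1"
        using B 2 by (auto simp: clifford_sign_def intro!: prod.neutral)
      hence "clifford_sign p {m} (insert b B) = eps p m"
        using B 2 by (simp add: clifford_sign_def)
      moreover have "sym_diff {m} (insert b B) = B" using B(3) 2 by auto
      moreover have "v m * P (insert b B) = eps p m *\<^sub>R P B"
        using P_insert[OF B(1,2)] square[OF insert.prems(1)] 2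
        by (simp add: mult.assoc[symmetric] scaleR_conv_of_real)
      ultimately show ?thesis by simp
    next
      case 3
      have fin: "finite (sym_diff {m} B)" and lt: "\<forall>c\<in>sym_diff {m} B. b < c"
        using B 3 by auto
      have "clifford_sign p {m} (insert b B) = - clifford_sign p {m} B"
        using B 3 by (simp add: clifford_sign_def)
      moreover have "sym_diff {m} (insert b B) = insert b (sym_diff {m} B)" using 3 B(3) by auto
      moreover have "v m * P (insert b B) = - (v b * (v m * P B))"
        using P_insert[OF B(1,2)] anticomm[of m b] insert.prems 3
        by (simp add: mult.assoc[symmetric])
      moreover have "v m * P B = clifford_sign p {m} B *\<^sub>R P (sym_diff {m} B)"
        using insert.IH insert.prems by auto
      ultimately show ?thesis by (simp only: P_insert[OF fin lt]) simp
    qed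
  qed
  have P_mult: "P A * P B = clifford_sign p A B *\<^sub>R P (sym_diff A B)"
    if "finite A" "A \<subseteq> ?I" "B \<subseteq> ?I" for A B
    using that
  proof (induction A rule: finite_linorder_min_induct)
    case empty
    thus ?case by (simp add: P_empty)
  next
    case (insert a A)
    have A: "finite A" "\<forall>c\<in>A. a < c" "a \<notin> A" using insert.hyps by auto
    have fin: "finite B" using insert.prems finite_subset by blast
    have ins: "insert a A = sym_diff {a} A" using A(3) by auto
    have sd: "sym_diff (insert a A) B = sym_diff {a} (sym_diff A B)" using A(3) by auto
    have "clifford_sign p {a} A = 1"
      using A by (auto simp: clifford_sign_def intro!: prod.neutral)
    hence sign: "clifford_sign p (insert a A) B =
        clifford_sign p A B * clifford_sign p {a} (sym_diff A B)"
      unfolding ins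
      using clifford_sign_sym_diff_left[of "{a}" A p B]
        clifford_sign_sym_diff_right[of A B p "{a}"] A(1) fin
      by simp
    have "P (insert a A) * P B = v a * (P A * P B)"
      by (simp only: P_insert[OF A(1,2)] mult.assoc)
    also have "\<dots> = clifford_sign p A B *\<^sub>R (v a * P (sym_diff A B))"
      using insert by simp
    also have "v a * P (sym_diff A B) =
        clifford_sign p {a} (sym_diff A B) *\<^sub>R P (sym_diff {a} (sym_diff A B))"
      using insert.prems A(1) fin by (intro gen) auto
    finally show ?case by (simp only: sd sign scaleR_scaleR)
  qed
  define \<phi> where "\<phi> x = (\<Sum>A\<in>Pow ?I. x A *\<^sub>R P A)" for x :: "nat set \<Rightarrow> real"
  have basis: "\<phi> (clifford_basis A) = P A" if "A \<subseteq> ?I" for A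
  proof -
    have "\<phi> (clifford_basis A) = (\<Sum>B\<in>Pow ?I. if B = A then P B else 0)"
      unfolding \<phi>_def clifford_basis_def by (intro sum.cong) auto
    thus ?thesis using that by simp
  qed
  have "\<phi> (x \<otimes>\<^bsub>clifford p q\<^esub> y) = \<phi> x * \<phi> y" for x y
  proof -
    have "\<phi> (x \<otimes>\<^bsub>clifford p q\<^esub> y) = (\<Sum>C\<in>Pow ?I. \<Sum>A\<in>Pow ?I.
        (clifford_sign p A (sym_diff A C) * x A * y (sym_diff A C)) *\<^sub>R P C)"
      by (simp add: \<phi>_def clifford_simps scaleR_sum_left)
    also have "\<dots> = (\<Sum>A\<in>Pow ?I. \<Sum>C\<in>Pow ?I.
        (clifford_sign p A (sym_diff A C) * x A * y (sym_diff A C)) *\<^sub>R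
          P (sym_diff A (sym_diff A C)))"
      by (subst sum.swap) (simp only: sym_diff_cancel)
    also have "\<dots> = (\<Sum>A\<in>Pow ?I. \<Sum>B\<in>Pow ?I.
        (clifford_sign p A B * x A * y B) *\<^sub>R P (sym_diff A B))"
      by (intro sum.cong refl sum_Pow_sym_diff
          [where g = "\<lambda>B. (clifford_sign p A B * x A * y B) *\<^sub>R P (sym_diff A B)" for A]) auto
    also have "\<dots> = (\<Sum>A\<in>Pow ?I. \<Sum>B\<in>Pow ?I. (x A *\<^sub>R P A) * (y B *\<^sub>R P B))"
    proof (intro sum.cong refl)
      fix A B assume "A \<in> Pow ?I" "B \<in> Pow ?I"
      hence "P A * P B = clifford_sign p A B *\<^sub>R P (sym_diff A B)"
        by (intro P_mult) (auto intro: finite_subset)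
      thus "(clifford_sign p A B * x A * y B) *\<^sub>R P (sym_diff A B) =
          (x A *\<^sub>R P A) * (y B *\<^sub>R P B)"
        by (simp add: mult_ac)
    qed
    also have "\<dots> = \<phi> x * \<phi> y"
      by (simp add: \<phi>_def sum_product)
    finally show ?thesis .
  qed
  moreover have "\<phi> (clifford_basis {}) = 1"
    using basis[of "{}"] P_empty by simp
  moreover have "\<phi> (clifford_gen i) = v i" if "i \<in> ?I" for i
    using basis[of "{i}"] that P_insert[of "{}" i] P_empty by (simp add: clifford_gen_def)
  ultimately have "clifford_hom p q \<phi>" "\<forall>i\<in>?I. \<phi> (clifford_gen i) = v i"
    by (auto simp: clifford_hom_def clifford_simps(3))
      (auto simp: \<phi>_def clifford_simps sum.distrib scaleR_add_left scaleR_sum_right)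
  thus ?thesis by blast
qed

theorem clifford_hom_unique:
  assumes "clifford_hom p q \<phi>" "clifford_hom p q \<psi>"
    and "\<And>i. i \<in> {1..p+q} \<Longrightarrow> \<phi> (clifford_gen i) = \<psi> (clifford_gen i)"
    and "x \<in> carrier (clifford p q)"
  shows "\<phi> x = \<psi> x"
proof -
  interpret C: ring "clifford p q" by (rule clifford_ring)
  have smult: "c \<odot>\<^bsub>clifford p q\<^esub> x \<in> carrier (clifford p q)"
    if "x \<in> carrier (clifford p q)" for c x
    using that by (auto simp: clifford_simps)
  have basis: "\<phi> (clifford_basis A) = \<psi> (clifford_basis A)" if "finite A" "A \<subseteq> {1..p+q}" for A
    using that
  proof (induction A rule: finite_linorder_min_induct)
    case empty
    thus ?case using assms(1,2) by (simp add: clifford_hom_def clifford_simps(3))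
  next
    case (insert a A)
    have "clifford_basis (insert a A) = clifford_gen a \<otimes>\<^bsub>clifford p q\<^esub> clifford_basis A"
      using insert by (intro clifford_basis_insert) auto
    thus ?case
      using insert assms(1-3) clifford_gen_closed[of a p q] clifford_basis_closed[of A p q]
      by (simp add: clifford_hom_def)
  qed
  have hom_zero: "\<phi> \<zero>\<^bsub>clifford p q\<^esub> = 0" if "clifford_hom p q \<phi>" for \<phi> :: "_ \<Rightarrow> 'a"
  proof -
    have "\<phi> (0 \<odot>\<^bsub>clifford p q\<^esub> \<zero>\<^bsub>clifford p q\<^esub>) = 0 *\<^sub>R \<phi> \<zero>\<^bsub>clifford p q\<^esub>"
      using that by (simp add: clifford_hom_def)
    thus ?thesis by (simp add: clifford_simps)
  qed
  from assms(4) show ?thesis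
  proof (induction x rule: clifford_induct)
    case zero
    show ?case using hom_zero[OF assms(1)] hom_zero[OF assms(2)] by simp
  next
    case (add c A x)
    have "\<phi> (clifford_basis A) = \<psi> (clifford_basis A)"
      using add by (intro basis) (auto intro: finite_subset)
    thus ?case
      using add assms(1,2) clifford_basis_closed[of A p q] smult
      by (simp add: clifford_hom_def)
  qed
qed


section \<open>The transposition is an anti-involution\<close>

lemma clifford_sign_diagonal:
  assumes "finite A"
  shows "clifford_sign p A A = (-1) ^ (card A * (card A - 1) div 2) * (\<Prod>i\<in>A. eps p i)"
  using assms
proof (induction A rule: finite_linorder_min_induct)
  case empty
  show ?case by simp
next
  case (insert a A)
  have A: "finite A" "\<forall>c\<in>A. a < c" "a \<notin> A" using insert.hyps by auto
  have ins: "insert a A = sym_diff {a} A" using A(3) by auto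
  have "clifford_sign p {a} A = 1"
    using A by (auto simp: clifford_sign_def intro!: prod.neutral)
  moreover have "clifford_sign p A {a} = (\<Prod>b\<in>A. -1)"
    using A unfolding clifford_sign_def by (intro prod.cong) auto
  moreover have "clifford_sign p {a} {a} = eps p a"
    by (simp add: clifford_sign_def)
  ultimately have "clifford_sign p (insert a A) (insert a A) =
      eps p a * (-1) ^ card A * clifford_sign p A A"
    using A(1) unfolding ins
    by (subst clifford_sign_sym_diff_left, simp, simp,
        subst clifford_sign_sym_diff_right, simp, simp,
        subst clifford_sign_sym_diff_right, simp, simp) simp
  moreover have "Suc n * n div 2 = n + n * (n - 1) div 2" for n
    by (cases n) (auto simp: algebra_simps)
  ultimately show ?case
    using A insert.IH by (simp add: power_add mult_ac)
qed

lemma transposition_basis: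
  assumes "A \<subseteq> {1..p+q}"
  shows "transposition p q (clifford_basis A) =
    clifford_sign p A A \<odot>\<^bsub>clifford p q\<^esub> clifford_basis A"
  using assms finite_subset[OF assms]
  by (auto simp: transposition_def clifford_sign_diagonal clifford_basis_def clifford_simps)

theorem transposition_anti_involution:
  assumes "x \<in> carrier (clifford p q)" "y \<in> carrier (clifford p q)"
  shows "transposition p q x \<in> carrier (clifford p q)"
    and "transposition p q (x \<oplus>\<^bsub>clifford p q\<^esub> y) =
      transposition p q x \<oplus>\<^bsub>clifford p q\<^esub> transposition p q y"
    and "transposition p q (c \<odot>\<^bsub>clifford p q\<^esub> x) = c \<odot>\<^bsub>clifford p q\<^esub> transposition p q x"
    and "transposition p q (x \<otimes>\<^bsub>clifford p q\<^esub> y) =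
      transposition p q y \<otimes>\<^bsub>clifford p q\<^esub> transposition p q x"
    and "transposition p q \<one>\<^bsub>clifford p q\<^esub> = \<one>\<^bsub>clifford p q\<^esub>"
    and "transposition p q (transposition p q x) = x"
    and "transposition p q (clifford_gen i) = eps p i \<odot>\<^bsub>clifford p q\<^esub> clifford_gen i"
proof -
  let ?I = "{1..p+q}" and ?s = "clifford_sign p"
  show "transposition p q x \<in> carrier (clifford p q)"
    using assms by (auto simp: transposition_def clifford_simps)
  show "transposition p q (x \<oplus>\<^bsub>clifford p q\<^esub> y) =
      transposition p q x \<oplus>\<^bsub>clifford p q\<^esub> transposition p q y"
    "transposition p q (c \<odot>\<^bsub>clifford p q\<^esub> x) = c \<odot>\<^bsub>clifford p q\<^esub> transposition p q x"
    by (simp_all add: transposition_def clifford_simps algebra_simps)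
  show "transposition p q \<one>\<^bsub>clifford p q\<^esub> = \<one>\<^bsub>clifford p q\<^esub>"
    "transposition p q (clifford_gen i) = eps p i \<odot>\<^bsub>clifford p q\<^esub> clifford_gen i"
    by (auto simp: transposition_def clifford_simps clifford_basis_def clifford_gen_def)
  have tr: "transposition p q x = (\<lambda>A. ?s A A * x A)" if "x \<in> carrier (clifford p q)" for x
  proof
    fix A show "transposition p q x A = ?s A A * x A"
      using that finite_subset[of A ?I] clifford_sign_diagonal[of A p]
      by (cases "x A = 0") (auto simp: transposition_def clifford_simps)
  qed
  show "transposition p q (transposition p q x) = x"
    using tr[OF \<open>transposition p q x \<in> carrier (clifford p q)\<close>] tr[OF assms(1)]
    by (simp add: mult.assoc[symmetric] clifford_sign_square)
  have regroup: "a * (b * u) * (c * v) = d * (e * v * u)" if "a * b * c = d * e"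
    for a b c d e u v :: real
  proof -
    have "a * (b * u) * (c * v) = (a * b * c) * (u * v)" by (simp only: mult_ac)
    thus ?thesis unfolding that by (simp only: mult_ac)
  qed
  show "transposition p q (x \<otimes>\<^bsub>clifford p q\<^esub> y) =
      transposition p q y \<otimes>\<^bsub>clifford p q\<^esub> transposition p q x"
  proof
    fix C
    show "transposition p q (x \<otimes>\<^bsub>clifford p q\<^esub> y) C =
      (transposition p q y \<otimes>\<^bsub>clifford p q\<^esub> transposition p q x) C"
    proof (cases "C \<subseteq> ?I")
      case False
      have "z C = 0" if "z \<in> carrier (clifford p q)" for z
        using that False by (auto simp: clifford_simps)
      moreover have "transposition p q z \<in> carrier (clifford p q)"
        if "z \<in> carrier (clifford p q)" for z
        using that by (auto simp: transposition_def clifford_simps)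
      ultimately show ?thesis using assms clifford_mult_closed by metis
    next
      case True
      have "(transposition p q y \<otimes>\<^bsub>clifford p q\<^esub> transposition p q x) C =
        (\<Sum>A\<in>Pow ?I. ?s A (sym_diff A C) * (?s A A * y A) *
           (?s (sym_diff A C) (sym_diff A C) * x (sym_diff A C)))"
        unfolding tr[OF assms(1)] tr[OF assms(2)] clifford_simps(2) ..
      also have "\<dots> = (\<Sum>A\<in>Pow ?I. (\<lambda>B. ?s (sym_diff C B) B *
          (?s (sym_diff C B) (sym_diff C B) * y (sym_diff C B)) * (?s B B * x B)) (sym_diff C A))"
      proof (rule sum.cong[OF refl])
        fix A
        have "sym_diff C (sym_diff C A) = A" "sym_diff C A = sym_diff A C" by blast+
        thus "?s A (sym_diff A C) * (?s A A * y A) *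
           (?s (sym_diff A C) (sym_diff A C) * x (sym_diff A C)) =
          (\<lambda>B. ?s (sym_diff C B) B *
          (?s (sym_diff C B) (sym_diff C B) * y (sym_diff C B)) * (?s B B * x B)) (sym_diff C A)"
          by simp
      qed
      also have "\<dots> = (\<Sum>B\<in>Pow ?I. ?s (sym_diff C B) B *
          (?s (sym_diff C B) (sym_diff C B) * y (sym_diff C B)) * (?s B B * x B))"
        using True by (rule sum_Pow_sym_diff)
      also have "\<dots> = (\<Sum>B\<in>Pow ?I. ?s C C * (?s B (sym_diff B C) * x B * y (sym_diff B C)))"
      proof (rule sum.cong[OF refl])
        fix B assume "B \<in> Pow ?I"
        hence fin: "finite B" "finite C" using True by (auto intro: finite_subset)
        have eq: "sym_diff C B = sym_diff B C" by blast
        note sgn = clifford_sign_sym_diff_left[OF fin] clifford_sign_sym_diff_right[OF fin]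
        have sq: "?s B B * ?s B B = 1" "?s C B * ?s C B = 1"
          by (rule clifford_sign_square)+
        have "?s (sym_diff B C) B * ?s (sym_diff B C) (sym_diff B C) * ?s B B =
            ?s C C * ?s B (sym_diff B C) * (?s B B * ?s B B) * (?s C B * ?s C B)"
          unfolding sgn by (simp only: mult_ac)
        hence "?s (sym_diff B C) B * ?s (sym_diff B C) (sym_diff B C) * ?s B B =
            ?s C C * ?s B (sym_diff B C)"
          unfolding sq by (simp only: mult_1_right)
        thus "?s (sym_diff C B) B * (?s (sym_diff C B) (sym_diff C B) * y (sym_diff C B)) *
            (?s B B * x B) = ?s C C * (?s B (sym_diff B C) * x B * y (sym_diff B C))"
          unfolding eq using regroup by blast
      qed
      also have "\<dots> = transposition p q (x \<otimes>\<^bsub>clifford p q\<^esub> y) C"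
        unfolding tr[OF clifford_mult_closed[OF assms]]
        by (simp only: clifford_simps(2) sum_distrib_left)
      finally show ?thesis by simp
    qed
  qed
qed

theorem transposition_unique:
  assumes closed: "\<And>x. x \<in> carrier (clifford p q) \<Longrightarrow> T x \<in> carrier (clifford p q)"
    and add: "\<And>x y. x \<in> carrier (clifford p q) \<Longrightarrow> y \<in> carrier (clifford p q) \<Longrightarrow>
      T (x \<oplus>\<^bsub>clifford p q\<^esub> y) = T x \<oplus>\<^bsub>clifford p q\<^esub> T y"
    and smult: "\<And>c x. x \<in> carrier (clifford p q) \<Longrightarrow>
      T (c \<odot>\<^bsub>clifford p q\<^esub> x) = c \<odot>\<^bsub>clifford p q\<^esub> T x"
    and mult: "\<And>x y. x \<in> carrier (clifford p q) \<Longrightarrow> y \<in> carrier (clifford p q) \<Longrightarrow>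
      T (x \<otimes>\<^bsub>clifford p q\<^esub> y) = T y \<otimes>\<^bsub>clifford p q\<^esub> T x"
    and one: "T \<one>\<^bsub>clifford p q\<^esub> = \<one>\<^bsub>clifford p q\<^esub>"
    and gen: "\<And>i. i \<in> {1..p+q} \<Longrightarrow> T (clifford_gen i) = eps p i \<odot>\<^bsub>clifford p q\<^esub> clifford_gen i"
    and x: "x \<in> carrier (clifford p q)"
  shows "T x = transposition p q x"
proof -
  have zero_closed: "\<zero>\<^bsub>clifford p q\<^esub> \<in> carrier (clifford p q)"
    by (simp add: clifford_simps)
  have smult_closed: "c \<odot>\<^bsub>clifford p q\<^esub> x \<in> carrier (clifford p q)"
    if "x \<in> carrier (clifford p q)" for c x
    using that by (auto simp: clifford_simps)
  note tr = transposition_anti_involution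
  have basis: "T (clifford_basis A) = transposition p q (clifford_basis A)"
    if "finite A" "A \<subseteq> {1..p+q}" for A
    using that
  proof (induction A rule: finite_linorder_min_induct)
    case empty
    show ?case using one tr(5)[OF zero_closed zero_closed] by (simp add: clifford_simps(3))
  next
    case (insert a A)
    have c: "clifford_gen a \<in> carrier (clifford p q)" "clifford_basis A \<in> carrier (clifford p q)"
      using insert.prems by (simp_all add: clifford_gen_closed clifford_basis_closed)
    have eq: "clifford_basis (insert a A) = clifford_gen a \<otimes>\<^bsub>clifford p q\<^esub> clifford_basis A"
      using insert by (intro clifford_basis_insert) auto
    show ?case
      unfolding eq mult[OF c] tr(4)[OF c] using insert gen[of a] tr(7)[OF c, of a] by simp
  qed
  from x show ?thesis
  proof (induction x rule: clifford_induct)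
    case zero
    show ?case
      using smult[OF zero_closed, of 0] tr(3)[OF zero_closed zero_closed, of 0]
      by (simp add: clifford_simps)
  next
    case (add c A x)
    have c: "clifford_basis A \<in> carrier (clifford p q)"
      using add.hyps(1) by (rule clifford_basis_closed)
    have "T (clifford_basis A) = transposition p q (clifford_basis A)"
      using add by (intro basis) (auto intro: finite_subset)
    thus ?case
      using assms(2)[OF smult_closed[OF c] add(2)] tr(2)[OF smult_closed[OF c] add(2)]
        smult[OF c] tr(3)[OF c c] add(3) by simp
  qed
qed

end

theory Submission
  imports Defs
begin

text \<open>
  Let \<open>K\<close> be \<open>R\<close>, \<open>C\<close> or \<open>H\<close>. Suppose that \<open>p\<close> matrices of square \<open>1\<close> and \<open>q\<close> matrices of square
  \<open>-1\<close> over \<open>K\<close> are unitary, anticommute pairwise and generate \<open>Mat(N, K)\<close> as a real algebra. Then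
  the universal property gives a surjection of the Clifford algebra onto \<open>Mat(N, K)\<close>, injective by
  simplicity. Since a unitary \<open>E\<close> with \<open>E\<^sup>2 = \<epsilon>\<close> has adjoint \<open>\<epsilon> E\<close>, uniqueness of the
  transposition identifies it with the adjoint, and its group with the unitary group over \<open>K\<close>.
  Primitive idempotents of \<open>Mat(N, K)\<close> have rank one, so their corners are isomorphic to \<open>K\<close>.

  Such matrices arise from the signatures \<open>(0,0)\<close>, \<open>(0,1)\<close>, \<open>(0,2)\<close> with \<open>N = 1\<close> over \<open>R\<close>, \<open>C\<close>, \<open>H\<close>
  by three moves: \<open>(p,q) \<rightarrow> (p+1,q+1)\<close>, doubling \<open>N\<close>, by block matrices, and
  \<open>(p+1,q) \<rightarrow> (q+1,p)\<close> and \<open>(p+4,q) \<leftrightarrow> (p,q+4)\<close>, keeping \<open>N\<close>, by multiplying some of the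
  matrices with a product of matrices of the system. If \<open>p - q\<close> is \<open>1\<close> modulo \<open>4\<close>, the volume element
  is central with square \<open>1\<close>, so the Clifford algebra is not simple.
\<close>

section \<open>Real division algebras with conjugation\<close>

text \<open>Treats the reals, complex numbers and quaternions at once. Conjugation reverses
  products, as the quaternions demand; division serves the study of corner rings.\<close>

class star_algebra = real_div_algebra +
  fixes cj :: "'a \<Rightarrow> 'a"
  assumes cj_add: "cj (x + y) = cj x + cj y"
    and cj_mult: "cj (x * y) = cj y * cj x"
    and cj_scaleR: "cj (scaleR c x) = scaleR c (cj x)"
    and cj_cj [simp]: "cj (cj x) = x"
begin

lemma cj_0 [simp]: "cj 0 = 0"
  using cj_add[of 0 0] by simp

text \<open>Applying \<open>cj\<close> to \<open>cj 1 * 1\<close> gives \<open>1\<close> when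
  computed directly and \<open>cj 1\<close> by the product rule.\<close>

lemma cj_1 [simp]: "cj 1 = 1"
  using cj_mult[of "cj 1" 1] by simp

lemma cj_minus [simp]: "cj (- x) = - cj x"
  using cj_add[of x "- x"] by (simp add: eq_neg_iff_add_eq_0 add.commute)

lemma cj_sum: "cj (sum f A) = (\<Sum>a\<in>A. cj (f a))"
  by (induction A rule: infinite_finite_induct) (simp_all add: cj_add)

end

instantiation real :: star_algebra
begin
definition cj_real :: "real \<Rightarrow> real" where "cj_real x = x"
instance by standard (simp_all add: cj_real_def)
end

instantiation complex :: star_algebra
begin
definition cj_complex :: "complex \<Rightarrow> complex" where "cj_complex = cnj"
instance by standard (simp_all add: cj_complex_def scaleR_conv_of_real)
end

section \<open>The quaternions as a division algebra with conjugation\<close>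

definition quat_norm2 :: "quat \<Rightarrow> real" where
  "quat_norm2 x = (qr x)\<^sup>2 + (qi x)\<^sup>2 + (qj x)\<^sup>2 + (qk x)\<^sup>2"

lemma quat_sel [simp]:
  "qr 0 = 0" "qi 0 = 0" "qj 0 = 0" "qk 0 = 0"
  "qr 1 = 1" "qi 1 = 0" "qj 1 = 0" "qk 1 = 0"
  "qr (x + y) = qr x + qr y" "qi (x + y) = qi x + qi y"
  "qj (x + y) = qj x + qj y" "qk (x + y) = qk x + qk y"
  "qr (- x) = - qr x" "qi (- x) = - qi x" "qj (- x) = - qj x" "qk (- x) = - qk x"
  "qr (x * y) = qr x * qr y - qi x * qi y - qj x * qj y - qk x * qk y"
  "qi (x * y) = qr x * qi y + qi x * qr y + qj x * qk y - qk x * qj y"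
  "qj (x * y) = qr x * qj y - qi x * qk y + qj x * qr y + qk x * qi y"
  "qk (x * y) = qr x * qk y + qi x * qj y - qj x * qi y + qk x * qr y"
  by (simp_all add: zero_quat_def one_quat_def plus_quat_def uminus_quat_def times_quat_def)

lemma quat_norm2_eq_0 [simp]: "quat_norm2 x = 0 \<longleftrightarrow> x = 0"
proof -
  have "quat_norm2 x = 0 \<longleftrightarrow> (qr x)\<^sup>2 = 0 \<and> (qi x)\<^sup>2 = 0 \<and> (qj x)\<^sup>2 = 0 \<and> (qk x)\<^sup>2 = 0"
    unfolding quat_norm2_def by (smt (verit) zero_le_power2)
  thus ?thesis by (simp add: quat_eq_iff)
qed

instantiation quat :: star_algebra
begin

definition scaleR_quat :: "real \<Rightarrow> quat \<Rightarrow> quat" where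
  "scaleR_quat c x = Quat (c * qr x) (c * qi x) (c * qj x) (c * qk x)"

definition cj_quat :: "quat \<Rightarrow> quat" where
  "cj_quat = qcnj"

definition inverse_quat :: "quat \<Rightarrow> quat" where
  "inverse_quat x = inverse (quat_norm2 x) *\<^sub>R qcnj x"

definition divide_quat :: "quat \<Rightarrow> quat \<Rightarrow> quat" where
  "divide_quat x y = x * inverse y"

instance
proof
  show "x \<noteq> 0 \<Longrightarrow> inverse x * x = 1" "x \<noteq> 0 \<Longrightarrow> x * inverse x = 1" for x :: quat
  proof -
    assume "x \<noteq> 0"
    \<comment> \<open>With the inverse norm kept opaque, both identities follow from
      \<open>r * quat_norm2 x = 1\<close> by expanding polynomials.\<close>
    define r where "r = inverse (quat_norm2 x)"
    have "r * quat_norm2 x = 1" using \<open>x \<noteq> 0\<close> by (simp add: r_def)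
    thus "inverse x * x = 1" "x * inverse x = 1"
      unfolding inverse_quat_def r_def[symmetric]
      by (simp_all add: quat_eq_iff scaleR_quat_def qcnj_def quat_norm2_def
          power2_eq_square algebra_simps)
  qed
  show "inverse 0 = (0 :: quat)"
    by (simp add: quat_eq_iff inverse_quat_def scaleR_quat_def quat_norm2_def)
qed (simp_all add: quat_eq_iff divide_quat_def scaleR_quat_def cj_quat_def qcnj_def algebra_simps)

end

lemma quat_sel_scaleR [simp]:
  "qr (c *\<^sub>R x) = c * qr x" "qi (c *\<^sub>R x) = c * qi x"
  "qj (c *\<^sub>R x) = c * qj x" "qk (c *\<^sub>R x) = c * qk x"
  by (simp_all add: scaleR_quat_def)

section \<open>Adjoint matrices\<close>

definition adjoint_mat :: "'a::star_algebra mat \<Rightarrow> 'a mat" where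
  "adjoint_mat A = map_mat cj (transpose_mat A)"

definition scaleR_mat :: "real \<Rightarrow> 'a::real_vector mat \<Rightarrow> 'a mat" where
  "scaleR_mat c A = map_mat (scaleR c) A"

lemma adjoint_mat_carrier [simp]: "A \<in> carrier_mat n m \<Longrightarrow> adjoint_mat A \<in> carrier_mat m n"
  by (simp add: adjoint_mat_def)

lemma adjoint_mat_index [simp]:
  "i < dim_col A \<Longrightarrow> j < dim_row A \<Longrightarrow> adjoint_mat A $$ (i,j) = cj (A $$ (j,i))"
  "dim_row (adjoint_mat A) = dim_col A" "dim_col (adjoint_mat A) = dim_row A"
  by (simp_all add: adjoint_mat_def)

lemma scaleR_mat_carrier [simp]: "A \<in> carrier_mat n m \<Longrightarrow> scaleR_mat c A \<in> carrier_mat n m"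
  by (simp add: scaleR_mat_def)

lemma scaleR_mat_index [simp]:
  "i < dim_row A \<Longrightarrow> j < dim_col A \<Longrightarrow> scaleR_mat c A $$ (i,j) = c *\<^sub>R A $$ (i,j)"
  "dim_row (scaleR_mat c A) = dim_row A" "dim_col (scaleR_mat c A) = dim_col A"
  by (simp_all add: scaleR_mat_def)

lemma mult_carrier_sq [simp]:
  "A \<in> carrier_mat n n \<Longrightarrow> B \<in> carrier_mat n n \<Longrightarrow> A * B \<in> carrier_mat n n"
  by simp

lemma adjoint_mat_mult:
  assumes "A \<in> carrier_mat n m" "B \<in> carrier_mat m k"
  shows "adjoint_mat (A * B) = adjoint_mat B * adjoint_mat A"
  by (rule eq_matI) (use assms in \<open>auto simp: scalar_prod_def cj_sum cj_mult\<close>)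

lemma adjoint_mat_add:
  "A \<in> carrier_mat n m \<Longrightarrow> B \<in> carrier_mat n m \<Longrightarrow>
    adjoint_mat (A + B) = adjoint_mat A + adjoint_mat B"
  by (rule eq_matI) (auto simp: cj_add)

lemma adjoint_mat_scaleR: "adjoint_mat (scaleR_mat c A) = scaleR_mat c (adjoint_mat A)"
  by (rule eq_matI) (auto simp: cj_scaleR)

lemma adjoint_mat_uminus [simp]: "adjoint_mat (- A) = - adjoint_mat A"
  by (rule eq_matI) auto

lemma adjoint_mat_one [simp]: "adjoint_mat (1\<^sub>m n) = 1\<^sub>m n"
  by (rule eq_matI) auto

lemma adjoint_mat_zero [simp]: "adjoint_mat (0\<^sub>m n m) = 0\<^sub>m m n"
  by (rule eq_matI) auto

lemma adjoint_four_block_mat: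
  assumes "A \<in> carrier_mat n n" "B \<in> carrier_mat n m" "C \<in> carrier_mat m n" "D \<in> carrier_mat m m"
  shows "adjoint_mat (four_block_mat A B C D) =
    four_block_mat (adjoint_mat A) (adjoint_mat C) (adjoint_mat B) (adjoint_mat D)"
  by (rule eq_matI) (use assms in auto)

lemma uminus_uminus_mat [simp]: "- (- A) = (A :: 'a::group_add mat)"
  by (rule eq_matI) auto

lemma uminus_mat_eq_scaleR: "- A = scaleR_mat (-1) (A :: 'a::real_vector mat)"
  by (rule eq_matI) auto

section \<open>Clifford systems\<close>

text \<open>The unital real algebra generated by \<open>S\<close>. The inductive form allows
  surjectivity to be shown by following how a matrix is built from generators.\<close>

inductive_set mat_algebra :: "nat \<Rightarrow> 'a::real_algebra_1 mat set \<Rightarrow> 'a mat set" for N S where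
  one: "1\<^sub>m N \<in> mat_algebra N S"
| gen: "A \<in> S \<Longrightarrow> A \<in> mat_algebra N S"
| add: "A \<in> mat_algebra N S \<Longrightarrow> B \<in> mat_algebra N S \<Longrightarrow> A + B \<in> mat_algebra N S"
| mult: "A \<in> mat_algebra N S \<Longrightarrow> B \<in> mat_algebra N S \<Longrightarrow> A * B \<in> mat_algebra N S"
| scaleR: "A \<in> mat_algebra N S \<Longrightarrow> scaleR_mat c A \<in> mat_algebra N S"

lemma mat_algebra_mono:
  assumes "S \<subseteq> mat_algebra N T"
  shows "mat_algebra N S \<subseteq> mat_algebra N T"
proof
  fix A assume "A \<in> mat_algebra N S"
  thus "A \<in> mat_algebra N T"
    by induction (use assms in \<open>auto intro: mat_algebra.intros\<close>)
qed

lemma mat_algebra_closed: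
  assumes "S \<subseteq> carrier_mat N N"
  shows "mat_algebra N S \<subseteq> carrier_mat N N"
proof
  fix A assume "A \<in> mat_algebra N S"
  thus "A \<in> carrier_mat N N" by induction (use assms in auto)
qed

text \<open>\<open>ps\<close> and \<open>ms\<close> represent the generators of square 1 and -1.
  Lists are used because \<open>sorted_wrt\<close> imposes anticommutation on pairs of distinct
  positions only. The adjoint conditions later match the transposition with the adjoint, and the
  last conjunct gives surjectivity onto all matrices.\<close>

definition clifford_system ::
  "nat \<Rightarrow> 'a::star_algebra mat list \<Rightarrow> 'a mat list \<Rightarrow> bool" where
  "clifford_system N ps ms \<longleftrightarrow> N > 0 \<and> set (ps @ ms) \<subseteq> carrier_mat N N \<and>
     sorted_wrt (\<lambda>x y. x * y = - (y * x)) (ps @ ms) \<and>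
     (\<forall>x\<in>set ps. x * x = 1\<^sub>m N \<and> adjoint_mat x = x) \<and>
     (\<forall>x\<in>set ms. x * x = - 1\<^sub>m N \<and> adjoint_mat x = - x) \<and>
     carrier_mat N N \<subseteq> mat_algebra N (set (ps @ ms))"

lemma anticommute_sym: "x * y = - (y * x) \<longleftrightarrow> y * x = - (x * y)"
  for x y :: "'a::ring_1 mat"
  by (metis uminus_uminus_mat)

text \<open>In right-nested products a swap must also apply to two factors that are followed by a
  third.\<close>

lemma anticommute_left:
  fixes x y z :: "'a::ring_1 mat"
  assumes "x * y = - (y * x)" "x \<in> carrier_mat N N" "y \<in> carrier_mat N N" "z \<in> carrier_mat N N"
  shows "x * (y * z) = - (y * (x * z))"
  using assms assoc_mult_mat[of x N N y N z N] assoc_mult_mat[of y N N x N z N] by simp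

text \<open>Anticommutation is symmetric, so order within a list is immaterial; rotating puts a
  block where the flip below expects it.\<close>

lemma clifford_system_rotate:
  "clifford_system N (ps1 @ ps2) ms \<Longrightarrow> clifford_system N (ps2 @ ps1) ms"
  "clifford_system N ps (ms1 @ ms2) \<Longrightarrow> clifford_system N ps (ms2 @ ms1)"
  by (auto simp: clifford_system_def sorted_wrt_append Un_commute Un_left_commute anticommute_sym)

text \<open>Makes right-nested products the normal form in which factors are moved below.\<close>

lemma assoc_mult_sq [simp]:
  fixes A B C :: "'a::semiring_0 mat"
  assumes "A \<in> carrier_mat n n" "B \<in> carrier_mat n n" "C \<in> carrier_mat n n"
  shows "A * B * C = A * (B * C)"
  using assms by (rule assoc_mult_mat)

lemma mat_algebra_subset: "S \<subseteq> T \<Longrightarrow> mat_algebra N S \<subseteq> mat_algebra N T"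
  by (intro mat_algebra_mono) (auto intro: mat_algebra.gen)

text \<open>Common core of the two moves that keep \<open>N\<close>. Here \<open>h\<close> is a
  self-adjoint involution anticommuting with the blocks \<open>ps1\<close>, \<open>ms1\<close> and
  commuting with the rest. Replacing \<open>x\<close> by \<open>x * h\<close> in these blocks keeps
  anticommutation and reverses the sign of the square, so the blocks change sides. Assumption
  \<open>G\<close> ensures that the old generators can be recovered.\<close>

lemma clifford_system_flip:
  assumes sys: "clifford_system N (ps1 @ ps2) (ms1 @ ms2)"
    and h: "h \<in> carrier_mat N N" "h * h = 1\<^sub>m N" "adjoint_mat h = h"
    and L: "\<And>x. x \<in> set (ps1 @ ms1) \<Longrightarrow> h * x = - (x * h)"
    and R: "\<And>x. x \<in> set (ps2 @ ms2) \<Longrightarrow> h * x = x * h"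
    and G: "h \<in> mat_algebra N (set (map (\<lambda>x. x * h) (ps1 @ ms1) @ ps2 @ ms2))"
  shows "clifford_system N (map (\<lambda>x. x * h) ms1 @ ps2) (map (\<lambda>x. x * h) ps1 @ ms2)"
proof -
  let ?S = "set (ps1 @ ps2 @ ms1 @ ms2)"
  let ?T = "set (map (\<lambda>x. x * h) (ps1 @ ms1) @ ps2 @ ms2)"
  have N: "N > 0" and c: "\<And>x. x \<in> ?S \<Longrightarrow> x \<in> carrier_mat N N"
    and gen: "carrier_mat N N \<subseteq> mat_algebra N ?S"
    using sys by (auto simp: clifford_system_def Un_ac)
  \<comment> \<open>Moving \<open>h\<close> past \<open>y\<close> costs one sign, and then
    \<open>h * h\<close> disappears. The case \<open>x = y\<close> gives the new squares.\<close>
  have LL: "x * h * (y * h) = - (x * y)" if "x \<in> set (ps1 @ ms1)" "y \<in> set (ps1 @ ms1)" for x y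
  proof -
    have xy: "x \<in> carrier_mat N N" "y \<in> carrier_mat N N" using that c by auto
    have "x * h * (y * h) = x * (h * (y * h))" using xy h by simp
    also have "h * (y * h) = - (y * (h * h))"
      using anticommute_left[OF L[OF that(2)] h(1) xy(2) h(1)] .
    finally show ?thesis using xy h by simp
  qed
  have LR: "x * h * r = - (r * (x * h))"
    if "x \<in> set (ps1 @ ms1)" "r \<in> set (ps2 @ ms2)" "x * r = - (r * x)" for x r
  proof -
    have xr: "x \<in> carrier_mat N N" "r \<in> carrier_mat N N" using that c by auto
    have "x * h * r = x * (r * h)" using xr h R[OF that(2)] by simp
    also have "\<dots> = - (r * (x * h))" using anticommute_left[OF that(3) xr h(1)] .
    finally show ?thesis .
  qed
  have anti: "sorted_wrt (\<lambda>x y. x * y = - (y * x)) (ps1 @ ps2 @ ms1 @ ms2)"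
    using sys by (simp add: clifford_system_def)
  have "sorted_wrt (\<lambda>x y. x * y = - (y * x))
      (map (\<lambda>x. x * h) ms1 @ ps2 @ map (\<lambda>x. x * h) ps1 @ ms2)"
  proof -
    have m: "sorted_wrt (\<lambda>x y. x * h * (y * h) = - (y * h * (x * h))) xs"
      if "sorted_wrt (\<lambda>x y. x * y = - (y * x)) xs" "set xs \<subseteq> set (ps1 @ ms1)" for xs
      using that(1)
    proof (rule sorted_wrt_mono_rel[rotated])
      fix x y assume xy: "x \<in> set xs" "y \<in> set xs" "x * y = - (y * x)"
      hence "x * h * (y * h) = - (x * y)" "y * h * (x * h) = - (y * x)"
        using that(2) by (blast intro: LL)+
      thus "x * h * (y * h) = - (y * h * (x * h))" using xy(3) by simp
    qed
    have a: "x * y = - (y * x)" if "(x, y) \<in> set ps1 \<times> set ps2 \<union> set ms1 \<times> set ms2 \<union>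
        set ps1 \<times> set ms2 \<union> set ps2 \<times> set ms1 \<union> set ps1 \<times> set ms1 \<union> set ps2 \<times> set ms2" for x y
      using anti that by (auto simp: sorted_wrt_append)
    have a': "y * x = - (x * y)" if "(x, y) \<in> set ps1 \<times> set ps2 \<union> set ms1 \<times> set ms2 \<union>
        set ps1 \<times> set ms2 \<union> set ps2 \<times> set ms1 \<union> set ps1 \<times> set ms1 \<union> set ps2 \<times> set ms2" for x y
      using a[OF that] anticommute_sym by blast
    have "sorted_wrt (\<lambda>x y. x * h * (y * h) = - (y * h * (x * h))) ms1"
      "sorted_wrt (\<lambda>x y. x * h * (y * h) = - (y * h * (x * h))) ps1"
      "sorted_wrt (\<lambda>x y. x * y = - (y * x)) ps2"
      "sorted_wrt (\<lambda>x y. x * y = - (y * x)) ms2"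
      using anti by (auto simp: sorted_wrt_append intro!: m)
    moreover have "x * h * y = - (y * (x * h))" if "x \<in> set ms1" "y \<in> set ps2" for x y
      using that by (intro LR a') auto
    moreover have "x * h * (y * h) = - (y * h * (x * h))" if "x \<in> set ms1" "y \<in> set ps1" for x y
      using that by (simp add: LL a[of y x])
    moreover have "x * h * y = - (y * (x * h))" if "x \<in> set ms1" "y \<in> set ms2" for x y
      using that by (intro LR a) auto
    moreover have "x * (y * h) = - (y * h * x)" if "x \<in> set ps2" "y \<in> set ps1" for x y
      using that LR[of y x] a[of y x] anticommute_sym by auto
    moreover have "x * y = - (y * x)" if "x \<in> set ps2" "y \<in> set ms2" for x y
      using that by (intro a) auto
    moreover have "x * h * y = - (y * (x * h))" if "x \<in> set ps1" "y \<in> set ms2" for x y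
      using that by (intro LR a) auto
    ultimately show ?thesis
      unfolding sorted_wrt_append sorted_wrt_map by auto
  qed
  moreover have "set ((map (\<lambda>x. x * h) ms1 @ ps2) @ map (\<lambda>x. x * h) ps1 @ ms2) = ?T"
    by auto
  moreover have "?T \<subseteq> carrier_mat N N" using c h by auto
  \<comment> \<open>The adjoint of \<open>x * h\<close> is \<open>h\<close> times the adjoint of
    \<open>x\<close>; moving \<open>h\<close> back to the right produces the sign, which matches the
    new square.\<close>
  moreover have "adjoint_mat (x * h) = - (x * h)" if "x \<in> set ps1" for x
  proof -
    have "adjoint_mat x = x" using that sys by (auto simp: clifford_system_def)
    thus ?thesis using adjoint_mat_mult[of x N N h N] that c h L[of x] by simp
  qed
  moreover have "adjoint_mat (x * h) = x * h" if "x \<in> set ms1" for x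
  proof -
    have "adjoint_mat x = - x" using that sys by (auto simp: clifford_system_def)
    thus ?thesis using adjoint_mat_mult[of x N N h N] that c[of x] h L[of x] by simp
  qed
  moreover have "x * h * (x * h) = - 1\<^sub>m N" if "x \<in> set ps1" for x
    using LL[of x x] that sys by (auto simp: clifford_system_def)
  moreover have "x * h * (x * h) = 1\<^sub>m N" if "x \<in> set ms1" for x
    using LL[of x x] that sys by (auto simp: clifford_system_def)
  moreover have "carrier_mat N N \<subseteq> mat_algebra N ?T"
  proof -
    \<comment> \<open>An altered generator is recovered as \<open>x = (x * h) * h\<close>.\<close>
    have "x \<in> mat_algebra N ?T" if "x \<in> ?S" for x
    proof (cases "x \<in> set (ps2 @ ms2)")
      case True
      thus ?thesis by (auto intro: mat_algebra.gen)
    next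
      case False
      hence "x * h \<in> ?T" using that by auto
      hence "x * h * h \<in> mat_algebra N ?T" using G by (blast intro: mat_algebra.intros)
      thus ?thesis using c[OF that] h by simp
    qed
    thus ?thesis using gen mat_algebra_mono[of ?S N ?T] by blast
  qed
  ultimately show ?thesis
    using sys N unfolding clifford_system_def by auto
qed

text \<open>Flip with \<open>h = x\<close>: every other generator anticommutes with
  \<open>x\<close>, while \<open>x\<close> itself stays in place, so \<open>h\<close> is trivially
  generated.\<close>

lemma clifford_system_swap:
  assumes sys: "clifford_system N (x # ps) ms"
  shows "clifford_system N (x # map (\<lambda>y. y * x) ms) (map (\<lambda>y. y * x) ps)"
proof -
  have x: "x \<in> carrier_mat N N" "x * x = 1\<^sub>m N" "adjoint_mat x = x"
    and a: "\<And>y. y \<in> set (ps @ ms) \<Longrightarrow> x * y = - (y * x)"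
    using sys by (auto simp: clifford_system_def)
  have "clifford_system N (ps @ [x]) (ms @ [])"
    using clifford_system_rotate(1)[of N "[x]" ps ms] sys by simp
  hence "clifford_system N (map (\<lambda>y. y * x) ms @ [x]) (map (\<lambda>y. y * x) ps @ [])"
    by (rule clifford_system_flip) (use x a in \<open>auto intro: mat_algebra.gen\<close>)
  thus ?thesis using clifford_system_rotate(1)[of N "map (\<lambda>y. y * x) ms" "[x]"] by simp
qed

text \<open>Reversing four anticommuting factors takes six transpositions, hence costs no sign, and
  the four equal signs of squares or adjoints multiply to 1; so \<open>h\<close> is a self-adjoint
  involution. One of the four factors passes three others with a sign, so it anticommutes with
  \<open>h\<close>. A matrix anticommuting with all four picks up four signs and commutes with
  \<open>h\<close>.\<close>

lemma four_product:
  fixes a b c d :: "'a::star_algebra mat"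
  assumes "set [a, b, c, d] \<subseteq> carrier_mat N N"
    and "sorted_wrt (\<lambda>x y. x * y = - (y * x)) [a, b, c, d]"
    and "(\<forall>x\<in>set [a, b, c, d]. x * x = 1\<^sub>m N \<and> adjoint_mat x = x) \<or>
         (\<forall>x\<in>set [a, b, c, d]. x * x = - 1\<^sub>m N \<and> adjoint_mat x = - x)"
  defines "h \<equiv> a * (b * (c * d))"
  shows "h \<in> carrier_mat N N" "h * h = 1\<^sub>m N" "adjoint_mat h = h"
    and "\<And>x. x \<in> set [a, b, c, d] \<Longrightarrow> h * x = - (x * h)"
    and "\<And>x. x \<in> carrier_mat N N \<Longrightarrow> \<forall>y\<in>set [a, b, c, d]. x * y = - (y * x) \<Longrightarrow> h * x = x * h"
    and "h \<in> mat_algebra N ((\<lambda>x. x * h) ` set [a, b, c, d])"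
proof -
  have car: "a \<in> carrier_mat N N" "b \<in> carrier_mat N N" "c \<in> carrier_mat N N" "d \<in> carrier_mat N N"
    using assms(1) by auto
  have swap: "b * a = - (a * b)" "c * a = - (a * c)" "d * a = - (a * d)"
      "c * b = - (b * c)" "d * b = - (b * d)" "d * c = - (c * d)"
    using assms(2) by (auto simp: anticommute_sym)
  have sq: "(a * a = 1\<^sub>m N \<and> b * b = 1\<^sub>m N \<and> c * c = 1\<^sub>m N \<and> d * d = 1\<^sub>m N) \<or>
      (a * a = - 1\<^sub>m N \<and> b * b = - 1\<^sub>m N \<and> c * c = - 1\<^sub>m N \<and> d * d = - 1\<^sub>m N)"
    using assms(3) by auto
  have sq_left: "x * (x * z) = u * z"
    if "x * x = u" "x \<in> carrier_mat N N" "z \<in> carrier_mat N N" for x z u :: "'a mat"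
    using that(2,3) by (simp flip: that(1))
  note left = anticommute_left[where N = N and ?'a = 'a]
  \<comment> \<open>As rewrite rules these sort the letters of a product alphabetically, so equal
    letters meet and cancel.\<close>
  note swaps = swap swap[THEN left]
  show h: "h \<in> carrier_mat N N" using car by (simp add: h_def)
  show hh: "h * h = 1\<^sub>m N"
    using sq
  proof
    assume s: "a * a = 1\<^sub>m N \<and> b * b = 1\<^sub>m N \<and> c * c = 1\<^sub>m N \<and> d * d = 1\<^sub>m N"
    note left_sq = sq_left[of _ "1\<^sub>m N"]
    thus ?thesis using car s by (simp add: h_def swaps left_sq)
  next
    assume s: "a * a = - 1\<^sub>m N \<and> b * b = - 1\<^sub>m N \<and> c * c = - 1\<^sub>m N \<and> d * d = - 1\<^sub>m N"
    note left_sq = sq_left[of _ "- 1\<^sub>m N"]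
    thus ?thesis using car s by (simp add: h_def swaps left_sq)
  qed
  show "adjoint_mat h = h"
    using assms(3) car by (auto simp: h_def adjoint_mat_mult[of _ N N _ N] swaps)
  show anti: "h * x = - (x * h)" if "x \<in> set [a, b, c, d]" for x
    using that car by (auto simp: h_def swaps)
  show "h * x = x * h" if "x \<in> carrier_mat N N" "\<forall>y\<in>set [a, b, c, d]. x * y = - (y * x)" for x
  proof -
    have "x * a = - (a * x)" "x * b = - (b * x)" "x * c = - (c * x)" "x * d = - (d * x)"
      using that(2) by auto
    moreover note this[THEN left]
    ultimately show ?thesis using that(1) car by (simp add: h_def)
  qed
  show "h \<in> mat_algebra N ((\<lambda>x. x * h) ` set [a, b, c, d])"
  proof -
    have hx: "h * a = - (a * h)" "h * b = - (b * h)" "h * c = - (c * h)" "h * d = - (d * h)"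
      using anti by auto
    \<comment> \<open>Each of the two pairs satisfies \<open>(x * h) * (y * h) = - (x * y)\<close>,
      and the two signs cancel.\<close>
    have "(a * h) * ((b * h) * ((c * h) * (d * h))) = h"
      using car h by (simp add: hx hx[THEN left] hh sq_left[OF hh]) (simp add: h_def)
    moreover have "(a * h) * ((b * h) * ((c * h) * (d * h))) \<in> mat_algebra N ((\<lambda>x. x * h) ` set [a, b, c, d])"
      by (intro mat_algebra.mult mat_algebra.gen) auto
    ultimately show ?thesis by simp
  qed
qed

text \<open>One of \<open>us\<close>, \<open>vs\<close> is the block of four and the other is empty,
  so one statement covers both directions of the shift. The remaining generators anticommute with
  all four, hence commute with \<open>h\<close>.\<close>

lemma clifford_system_shift:
  fixes a b c d :: "'a::star_algebra mat"
  assumes sys: "clifford_system N (us @ ps) (vs @ ms)"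
    and uv: "us = [a, b, c, d] \<and> vs = [] \<or> us = [] \<and> vs = [a, b, c, d]"
  defines "h \<equiv> a * (b * (c * d))"
  shows "clifford_system N (map (\<lambda>x. x * h) vs @ ps) (map (\<lambda>x. x * h) us @ ms)"
proof -
  have uvs: "us @ vs = [a, b, c, d]" using uv by auto
  have "sorted_wrt (\<lambda>x y. x * y = - (y * x)) (us @ vs)" and "set (us @ vs) \<subseteq> carrier_mat N N"
    using sys unfolding clifford_system_def sorted_wrt_append set_append by blast+
  moreover have "(\<forall>x\<in>set [a, b, c, d]. x * x = 1\<^sub>m N \<and> adjoint_mat x = x) \<or>
     (\<forall>x\<in>set [a, b, c, d]. x * x = - 1\<^sub>m N \<and> adjoint_mat x = - x)"
    using sys uv unfolding clifford_system_def set_append by blast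
  ultimately have pre: "set [a, b, c, d] \<subseteq> carrier_mat N N"
    "sorted_wrt (\<lambda>x y. x * y = - (y * x)) [a, b, c, d]"
    "(\<forall>x\<in>set [a, b, c, d]. x * x = 1\<^sub>m N \<and> adjoint_mat x = x) \<or>
     (\<forall>x\<in>set [a, b, c, d]. x * x = - 1\<^sub>m N \<and> adjoint_mat x = - x)"
    by (simp_all only: uvs)
  note h = four_product[of a b c d N, folded h_def, OF pre]
  have R: "h * x = x * h" if "x \<in> set (ps @ ms)" for x
  proof (rule h(5))
    show "x \<in> carrier_mat N N" using that sys by (auto simp: clifford_system_def)
    have "\<forall>y\<in>set (us @ vs). x * y = - (y * x) \<or> y * x = - (x * y)"
      using that sys unfolding clifford_system_def sorted_wrt_append set_append by blast
    thus "\<forall>y\<in>set [a, b, c, d]. x * y = - (y * x)"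
      unfolding uvs using anticommute_sym by blast
  qed
  have L: "h * x = - (x * h)" if "x \<in> set (us @ vs)" for x
    using h(4) that unfolding uvs .
  have "(\<lambda>x. x * h) ` set [a, b, c, d] \<subseteq> set (map (\<lambda>x. x * h) (us @ vs) @ ps @ ms)"
    unfolding set_append[of "map _ _"] set_map uvs by blast
  note G = subsetD[OF mat_algebra_subset[OF this] h(6)]
  show ?thesis by (rule clifford_system_flip[OF sys h(1-3) L R G])
qed

section \<open>Existence of Clifford systems\<close>

lemma mult_four_block_sq:
  fixes A1 :: "'a::semiring_0 mat"
  assumes "A1 \<in> carrier_mat N N" "B1 \<in> carrier_mat N N" "C1 \<in> carrier_mat N N" "D1 \<in> carrier_mat N N"
    "A2 \<in> carrier_mat N N" "B2 \<in> carrier_mat N N" "C2 \<in> carrier_mat N N" "D2 \<in> carrier_mat N N"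
  shows "four_block_mat A1 B1 C1 D1 * four_block_mat A2 B2 C2 D2 =
    four_block_mat (A1 * A2 + B1 * C2) (A1 * B2 + B1 * D2) (C1 * A2 + D1 * C2) (C1 * B2 + D1 * D2)"
  using assms by (rule mult_four_block_mat)

lemma uminus_four_block_mat:
  fixes A :: "'a::group_add mat"
  assumes "A \<in> carrier_mat n n" "B \<in> carrier_mat n m" "C \<in> carrier_mat m n" "D \<in> carrier_mat m m"
  shows "- four_block_mat A B C D = four_block_mat (- A) (- B) (- C) (- D)"
  by (rule eq_matI) (use assms in auto)

lemma scaleR_four_block_mat:
  fixes A :: "'a::real_vector mat"
  assumes "A \<in> carrier_mat n n" "B \<in> carrier_mat n m" "C \<in> carrier_mat m n" "D \<in> carrier_mat m m"
  shows "scaleR_mat c (four_block_mat A B C D) =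
    four_block_mat (scaleR_mat c A) (scaleR_mat c B) (scaleR_mat c C) (scaleR_mat c D)"
  by (rule eq_matI) (use assms in auto)

lemma uminus_zero_mat [simp]: "- 0\<^sub>m n m = (0\<^sub>m n m :: 'a::group_add mat)"
  by (rule eq_matI) auto

lemma scaleR_zero_mat [simp]: "scaleR_mat c (0\<^sub>m n m) = 0\<^sub>m n m"
  by (rule eq_matI) auto

lemma four_block_mat_cases:
  assumes "A \<in> carrier_mat (n + m) (n + m)"
  obtains A1 A2 A3 A4 where "A1 \<in> carrier_mat n n" "A2 \<in> carrier_mat n m"
    "A3 \<in> carrier_mat m n" "A4 \<in> carrier_mat m m" "A = four_block_mat A1 A2 A3 A4"
proof -
  have "A = four_block_mat (mat n n (\<lambda>(i,j). A $$ (i,j))) (mat n m (\<lambda>(i,j). A $$ (i,j+n)))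
    (mat m n (\<lambda>(i,j). A $$ (i+n,j))) (mat m m (\<lambda>(i,j). A $$ (i+n,j+n)))"
    by (rule eq_matI) (use assms in auto)
  thus thesis by (rule that[rotated -1]) auto
qed

text \<open>Tensor product with the 2 by 2 real system of signature (1,1): \<open>D x\<close> is
  \<open>x\<close> times diag(1,-1), and \<open>U\<close>, \<open>V\<close> are the off-diagonal
  symmetric and skew matrices, which anticommute with each other and with each
  \<open>D x\<close>.\<close>

lemma clifford_system_double:
  fixes ps ms :: "'a::star_algebra mat list"
  assumes sys: "clifford_system N ps ms"
  defines "D \<equiv> \<lambda>A :: 'a mat. four_block_mat A (0\<^sub>m N N) (0\<^sub>m N N) (- A)"
  defines "U \<equiv> four_block_mat (0\<^sub>m N N) (1\<^sub>m N) (1\<^sub>m N) (0\<^sub>m N N)"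
  defines "V \<equiv> four_block_mat (0\<^sub>m N N) (1\<^sub>m N) (- 1\<^sub>m N) (0\<^sub>m N N)"
  shows "clifford_system (N + N) (U # map D ps) (V # map D ms)"
proof -
  let ?S = "set (ps @ ms)" and ?T = "set ((U # map D ps) @ (V # map D ms))"
  have N: "N > 0" and c: "\<And>x. x \<in> ?S \<Longrightarrow> x \<in> carrier_mat N N"
    and gen: "carrier_mat N N \<subseteq> mat_algebra N ?S"
    and anti: "sorted_wrt (\<lambda>x y. x * y = - (y * x)) (ps @ ms)"
    using sys unfolding clifford_system_def by auto
  have one_blk: "1\<^sub>m (N + N) = four_block_mat (1\<^sub>m N) (0\<^sub>m N N) (0\<^sub>m N N) (1\<^sub>m N)" by simp
  note blk = mult_four_block_sq[where N = N] uminus_four_block_mat[where n = N and m = N]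
    scaleR_four_block_mat[where n = N and m = N] adjoint_four_block_mat[where n = N and m = N]
    add_four_block_mat[where ?nr1.0 = N and ?nc1.0 = N and ?nc2.0 = N and ?nr2.0 = N]
  have Dc: "D x \<in> carrier_mat (N + N) (N + N)" if "x \<in> carrier_mat N N" for x
    using that by (simp add: D_def)
  have DD: "D x * D y = four_block_mat (x * y) (0\<^sub>m N N) (0\<^sub>m N N) (x * y)"
    if "x \<in> carrier_mat N N" "y \<in> carrier_mat N N" for x y
    using that by (simp add: D_def blk)
  have UY: "U \<in> carrier_mat (N + N) (N + N)" "V \<in> carrier_mat (N + N) (N + N)"
    "U * U = 1\<^sub>m (N + N)" "V * V = - 1\<^sub>m (N + N)" "U * V = - (V * U)"
    "adjoint_mat U = U" "adjoint_mat V = - V"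
    unfolding one_blk by (simp_all add: U_def V_def blk del: four_block_one_mat)
  have UD: "U * D x = - (D x * U)" "D x * V = - (V * D x)" "V * D x = - (D x * V)"
    if "x \<in> carrier_mat N N" for x
    using that by (simp_all add: U_def V_def D_def blk)
  have "sorted_wrt (\<lambda>x y. x * y = - (y * x)) ((U # map D ps) @ (V # map D ms))"
  proof -
    have "sorted_wrt (\<lambda>x y. D x * D y = - (D y * D x)) (ps @ ms)"
      using anti
    proof (rule sorted_wrt_mono_rel[rotated])
      fix x y assume xy: "x \<in> ?S" "y \<in> ?S" "x * y = - (y * x)"
      show "D x * D y = - (D y * D x)"
        unfolding DD[OF xy(1,2)[THEN c]] DD[OF xy(2,1)[THEN c]] xy(3)
        using xy(1,2)[THEN c] by (simp add: blk)
    qed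
    thus ?thesis
      unfolding sorted_wrt_append sorted_wrt_map sorted_wrt.simps set_append set_map
      using c UD(1,2,3) UY(5) by auto
  qed
  moreover have "?T \<subseteq> carrier_mat (N + N) (N + N)" using c Dc UY by auto
  moreover have "D x * D x = 1\<^sub>m (N + N) \<and> adjoint_mat (D x) = D x" if "x \<in> set ps" for x
  proof -
    have "x \<in> carrier_mat N N" "x * x = 1\<^sub>m N" "adjoint_mat x = x"
      using that sys unfolding clifford_system_def by auto
    thus ?thesis by (simp add: DD) (simp add: D_def blk)
  qed
  moreover have "D x * D x = - 1\<^sub>m (N + N) \<and> adjoint_mat (D x) = - D x" if "x \<in> set ms" for x
  proof -
    have "x \<in> carrier_mat N N" "x * x = - 1\<^sub>m N" "adjoint_mat x = - x"
      using that sys unfolding clifford_system_def by auto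
    thus ?thesis unfolding one_blk by (simp add: DD blk del: four_block_one_mat) (simp add: D_def blk)
  qed
  moreover have "carrier_mat (N + N) (N + N) \<subseteq> mat_algebra (N + N) ?T"
  proof
    let ?G = "mat_algebra (N + N) ?T"
    \<comment> \<open>\<open>Z\<close> equals \<open>V * U\<close>, and \<open>P\<close> is the
      projection onto its eigenvalue 1; together with \<open>U\<close> it isolates single
      blocks.\<close>
    define Z where "Z = four_block_mat (1\<^sub>m N) (0\<^sub>m N N) (0\<^sub>m N N) (- 1\<^sub>m N :: 'a mat)"
    define P where "P = four_block_mat (1\<^sub>m N) (0\<^sub>m N N) (0\<^sub>m N N) (0\<^sub>m N N :: 'a mat)"
    have UG: "U \<in> ?G" "V \<in> ?G" by (auto intro: mat_algebra.gen)
    hence "V * U \<in> ?G" by (rule mat_algebra.mult[rotated])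
    moreover have ZVU: "Z = V * U" by (simp add: U_def V_def Z_def blk)
    ultimately have Z: "Z \<in> ?G" by simp
    have "P = scaleR_mat (1/2) (1\<^sub>m (N + N) + Z)"
      by (rule eq_matI) (auto simp: P_def Z_def)
    hence P: "P \<in> ?G" using Z by (auto intro!: mat_algebra.scaleR mat_algebra.add mat_algebra.one)
    \<comment> \<open>The generated algebra contains every diag(A,A): on generators this is
      \<open>D A * Z\<close>, and forming diag(A,A) respects the algebra operations.\<close>
    have diag: "four_block_mat A (0\<^sub>m N N) (0\<^sub>m N N) A \<in> ?G" if "A \<in> carrier_mat N N" for A
    proof -
      have "A \<in> mat_algebra N ?S" using that gen by blast
      thus ?thesis
      proof induction
        case one
        show ?case unfolding one_blk[symmetric] by (rule mat_algebra.one)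
      next
        case (gen A)
        hence "D A \<in> ?T" by auto
        hence "D A * Z \<in> ?G" using Z by (intro mat_algebra.mult mat_algebra.gen[of "D A"])
        thus ?case using c[OF gen] by (simp add: D_def Z_def blk)
      next
        case (add A B)
        hence "A \<in> carrier_mat N N" "B \<in> carrier_mat N N"
          using mat_algebra_closed[of ?S N] c by auto
        thus ?case using mat_algebra.add[OF add.IH] by (simp add: blk)
      next
        case (mult A B)
        hence "A \<in> carrier_mat N N" "B \<in> carrier_mat N N"
          using mat_algebra_closed[of ?S N] c by auto
        thus ?case using mat_algebra.mult[OF mult.IH] by (simp add: blk)
      next
        case (scaleR A r)
        hence "A \<in> carrier_mat N N"
          using mat_algebra_closed[of ?S N] c by auto
        thus ?case using mat_algebra.scaleR[OF scaleR.IH, of r] by (simp add: blk)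
      qed
    qed
    define d where "d A = four_block_mat A (0\<^sub>m N N) (0\<^sub>m N N) (A :: 'a mat)" for A
    fix A :: "'a mat" assume "A \<in> carrier_mat (N + N) (N + N)"
    then obtain A1 A2 A3 A4 where A: "A1 \<in> carrier_mat N N" "A2 \<in> carrier_mat N N"
      "A3 \<in> carrier_mat N N" "A4 \<in> carrier_mat N N" "A = four_block_mat A1 A2 A3 A4"
      by (rule four_block_mat_cases)
    \<comment> \<open>\<open>P * d B\<close> is \<open>B\<close> in the upper left corner;
      multiplying by \<open>U\<close> on the left swaps block rows, on the right block
      columns.\<close>
    have "A = P * d A1 + P * d A2 * U + (U * (P * d A3) + U * (P * d A4) * U)"
      unfolding d_def P_def U_def A(5) using A by (simp add: blk)
    moreover have "\<dots> \<in> ?G"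
      unfolding d_def using A P UG
      by (intro mat_algebra.add mat_algebra.mult diag) auto
    ultimately show "A \<in> ?G" by simp
  qed
  ultimately show ?thesis
    unfolding clifford_system_def using N UY by auto
qed

section \<open>The moves between signatures\<close>

definition clifford_representable ::
  "'a::star_algebra itself \<Rightarrow> nat \<Rightarrow> nat \<Rightarrow> nat \<Rightarrow> bool" where
  "clifford_representable _ p q k \<longleftrightarrow>
     (\<exists>ps ms :: 'a mat list. clifford_system (2 ^ k) ps ms \<and> length ps = p \<and> length ms = q)"

lemma clifford_representable_double:
  assumes "clifford_representable TYPE('a::star_algebra) p q k"
  shows "clifford_representable TYPE('a) (p + m) (q + m) (k + m)"
proof (induction m)
  case 0
  show ?case using assms by simp
next
  case (Suc m)
  then obtain ps ms :: "'a mat list" where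
    "clifford_system (2 ^ (k + m)) ps ms" "length ps = p + m" "length ms = q + m"
    unfolding clifford_representable_def by blast
  thus ?case
    unfolding clifford_representable_def
    by (intro exI conjI) (use clifford_system_double[of "2 ^ (k + m)" ps ms] in \<open>auto simp: mult_2\<close>)
qed

lemma clifford_representable_swap:
  assumes "clifford_representable TYPE('a::star_algebra) (Suc p) q k"
  shows "clifford_representable TYPE('a) (Suc q) p k"
proof -
  obtain ps ms :: "'a mat list" where
    *: "clifford_system (2 ^ k) ps ms" "length ps = Suc p" "length ms = q"
    using assms unfolding clifford_representable_def by blast
  obtain x ps' where "ps = x # ps'" using *(2) by (cases ps) auto
  thus ?thesis
    unfolding clifford_representable_def
    using clifford_system_swap[of "2 ^ k" x ps' ms] *
    by (intro exI[of _ "x # map (\<lambda>y. y * x) ms"] exI[of _ "map (\<lambda>y. y * x) ps'"]) auto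
qed

lemma clifford_representable_shift:
  "clifford_representable TYPE('a::star_algebra) (p + 4) q k \<longleftrightarrow>
   clifford_representable TYPE('a) p (q + 4) k"
proof
  assume "clifford_representable TYPE('a) (p + 4) q k"
  then obtain ps ms :: "'a mat list" where
    *: "clifford_system (2 ^ k) ps ms" "length ps = p + 4" "length ms = q"
    unfolding clifford_representable_def by blast
  then obtain a b c d ps' where "ps = [a, b, c, d] @ ps'" "length ps' = p"
    by (auto simp: length_Suc_conv numeral_eq_Suc)
  thus "clifford_representable TYPE('a) p (q + 4) k"
    unfolding clifford_representable_def
    using clifford_system_shift[of "2 ^ k" "[a, b, c, d]" ps' "[]" ms a b c d] *
    by (intro exI conjI) auto
next
  assume "clifford_representable TYPE('a) p (q + 4) k"
  then obtain ps ms :: "'a mat list" where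
    *: "clifford_system (2 ^ k) ps ms" "length ps = p" "length ms = q + 4"
    unfolding clifford_representable_def by blast
  then obtain a b c d ms' where "ms = [a, b, c, d] @ ms'" "length ms' = q"
    by (auto simp: length_Suc_conv numeral_eq_Suc)
  thus "clifford_representable TYPE('a) (p + 4) q k"
    unfolding clifford_representable_def
    using clifford_system_shift[of "2 ^ k" "[]" ps "[a, b, c, d]" ms' a b c d] *
    by (intro exI conjI) auto
qed

lemma clifford_representable_shift_mult:
  "clifford_representable TYPE('a::star_algebra) (p + 4 * t) q k \<longleftrightarrow>
   clifford_representable TYPE('a) p (q + 4 * t) k"
proof (induction t arbitrary: p q)
  case (Suc t)
  have "p + 4 * Suc t = p + 4 * t + 4" "q + 4 * Suc t = (q + 4) + 4 * t" by auto
  thus ?case using clifford_representable_shift[of "p + 4 * t" q k] Suc[of p "q + 4"] by metis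
qed simp

lemma clifford_representable_mod8:
  assumes "clifford_representable TYPE('a::star_algebra) p q k"
    and "p + q = p' + q'" "(int p - int q) mod 8 = (int p' - int q') mod 8"
  shows "clifford_representable TYPE('a) p' q' k"
proof -
  have "8 dvd (int p - int q) - (int p' - int q')"
    using assms(3) by (simp add: mod_eq_dvd_iff)
  then obtain t where "(int p - int q) - (int p' - int q') = 8 * t" ..
  \<comment> \<open>The sum of the signature is fixed, so a change of \<open>8 * t\<close> in the
    difference moves \<open>4 * t\<close> generators from one side to the other. The sign of
    \<open>t\<close> decides the direction.\<close>
  hence t: "int p = int p' + 4 * t" "int q' = int q + 4 * t" using assms(2) by linarith+
  show ?thesis
  proof (cases "t \<ge> 0")
    case True
    hence "p = p' + 4 * nat t" "q' = q + 4 * nat t" using t by linarith+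
    thus ?thesis using assms(1) clifford_representable_shift_mult by metis
  next
    case False
    hence "p' = p + 4 * nat (- t)" "q = q' + 4 * nat (- t)" using t by linarith+
    thus ?thesis using assms(1) clifford_representable_shift_mult by metis
  qed
qed

section \<open>The three initial signatures and those reached from them\<close>

lemma clifford_representable_real: "clifford_representable TYPE(real) 0 0 0"
proof -
  have "A \<in> mat_algebra 1 {}" if "A \<in> carrier_mat 1 1" for A :: "real mat"
  proof -
    have "A = scaleR_mat (A $$ (0,0)) (1\<^sub>m 1)" using that by (intro eq_matI) auto
    thus ?thesis by (metis mat_algebra.intros(1,5))
  qed
  thus ?thesis
    unfolding clifford_representable_def clifford_system_def
    by (intro exI[of _ "[]"]) auto
qed

lemma clifford_representable_complex: "clifford_representable TYPE(complex) 0 1 0"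
proof -
  let ?i = "mat 1 1 (\<lambda>_. \<i>)"
  have "A \<in> mat_algebra 1 {?i}" if "A \<in> carrier_mat 1 1" for A :: "complex mat"
  proof -
    have "A = scaleR_mat (Re (A $$ (0,0))) (1\<^sub>m 1) + scaleR_mat (Im (A $$ (0,0))) ?i"
      using that by (intro eq_matI) (auto simp: complex_eq_iff)
    moreover have "\<dots> \<in> mat_algebra 1 {?i}" by (intro mat_algebra.intros) auto
    ultimately show ?thesis by simp
  qed
  moreover have "?i * ?i = - 1\<^sub>m 1" "adjoint_mat ?i = - ?i"
    by (rule eq_matI; simp add: scalar_prod_def cj_complex_def)+
  ultimately show ?thesis
    unfolding clifford_representable_def clifford_system_def
    by (intro exI[of _ "[]"] exI[of _ "[?i]"]) auto
qed

lemma clifford_representable_quat: "clifford_representable TYPE(quat) 0 2 0"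
proof -
  let ?i = "mat 1 1 (\<lambda>_. Quat 0 1 0 0)" and ?j = "mat 1 1 (\<lambda>_. Quat 0 0 1 0)"
  have "A \<in> mat_algebra 1 {?i, ?j}" if "A \<in> carrier_mat 1 1" for A :: "quat mat"
  proof -
    have "A = scaleR_mat (qr (A $$ (0,0))) (1\<^sub>m 1) + scaleR_mat (qi (A $$ (0,0))) ?i +
      (scaleR_mat (qj (A $$ (0,0))) ?j + scaleR_mat (qk (A $$ (0,0))) (?i * ?j))"
      using that by (intro eq_matI) (auto simp: quat_eq_iff scalar_prod_def)
    moreover have "\<dots> \<in> mat_algebra 1 {?i, ?j}" by (intro mat_algebra.intros) auto
    ultimately show ?thesis by simp
  qed
  moreover have "?i * ?i = - 1\<^sub>m 1" "adjoint_mat ?i = - ?i" "?j * ?j = - 1\<^sub>m 1"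
    "adjoint_mat ?j = - ?j" "?i * ?j = - (?j * ?i)"
    by (rule eq_matI; simp add: scalar_prod_def cj_quat_def qcnj_def quat_eq_iff)+
  ultimately show ?thesis
    unfolding clifford_representable_def clifford_system_def
    by (intro exI[of _ "[]"] exI[of _ "[?i, ?j]"]) auto
qed

text \<open>Residue 0 comes from doubling (0,0) to (k,k). Residue 2 follows the path (0,0), (1,1),
  (2,0) by a doubling and a swap, then (2+m,m) by further doublings. Shifts by four reach the rest
  of each class.\<close>

lemma clifford_representable_realI:
  assumes "(int p - int q) mod 8 \<in> {0, 2}" "p + q = 2 * k"
  shows "clifford_representable TYPE(real) p q k"
proof -
  from assms(1) consider "(int p - int q) mod 8 = 0" | "(int p - int q) mod 8 = 2" by auto
  thus ?thesis
  proof cases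
    case 1
    have "clifford_representable TYPE(real) k k k"
      using clifford_representable_double[OF clifford_representable_real, of k] by simp
    thus ?thesis by (rule clifford_representable_mod8) (use 1 assms(2) in auto)
  next
    case 2
    \<comment> \<open>For \<open>k = 0\<close> the signature is (0,0), of residue 0. The positive
      \<open>k\<close> provides the doubling needed before the swap.\<close>
    have "k \<noteq> 0" using 2 assms(2) by (cases k) auto
    then obtain m where m: "k = Suc m" by (cases k) auto
    have "clifford_representable TYPE(real) (Suc 0) 1 1"
      using clifford_representable_double[OF clifford_representable_real, of 1] by simp
    from clifford_representable_double[OF clifford_representable_swap[OF this], of m]
    have "clifford_representable TYPE(real) (2 + m) m (Suc m)" by simp
    thus ?thesis unfolding m by (rule clifford_representable_mod8) (use 2 assms(2) m in auto)
  qed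
qed

text \<open>Residue 7 comes from (0,1) by doubling, residue 3 by the path (0,1), (1,2), (3,0) and
  further doublings.\<close>

lemma clifford_representable_complexI:
  assumes "(int p - int q) mod 8 \<in> {3, 7}" "p + q = 2 * k + 1"
  shows "clifford_representable TYPE(complex) p q k"
proof -
  from assms(1) consider "(int p - int q) mod 8 = 7" | "(int p - int q) mod 8 = 3" by auto
  thus ?thesis
  proof cases
    case 1
    have "clifford_representable TYPE(complex) k (Suc k) k"
      using clifford_representable_double[OF clifford_representable_complex, of k] by simp
    thus ?thesis by (rule clifford_representable_mod8) (use 1 assms(2) in auto)
  next
    case 2
    have "k \<noteq> 0"
    proof
      assume "k = 0"
      hence "p = 0 \<and> q = 1 \<or> p = 1 \<and> q = 0" using assms(2) by auto
      thus False using 2 by auto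
    qed
    then obtain m where m: "k = Suc m" by (cases k) auto
    have "clifford_representable TYPE(complex) (Suc 0) 2 1"
      using clifford_representable_double[OF clifford_representable_complex, of 1]
      by (simp add: numeral_2_eq_2)
    from clifford_representable_double[OF clifford_representable_swap[OF this], of m]
    have "clifford_representable TYPE(complex) (3 + m) m (Suc m)" by (simp add: numeral_3_eq_3)
    thus ?thesis unfolding m by (rule clifford_representable_mod8) (use 2 assms(2) m in auto)
  qed
qed

text \<open>Residue 6 comes from (0,2) by doubling, residue 4 by the path (0,2), (1,3), (4,0) and
  further doublings.\<close>

lemma clifford_representable_quatI:
  assumes "(int p - int q) mod 8 \<in> {4, 6}" "p + q = 2 * k + 2"
  shows "clifford_representable TYPE(quat) p q k"
proof -
  from assms(1) consider "(int p - int q) mod 8 = 6" | "(int p - int q) mod 8 = 4" by auto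
  thus ?thesis
  proof cases
    case 1
    have "clifford_representable TYPE(quat) k (k + 2) k"
      using clifford_representable_double[OF clifford_representable_quat, of k] by simp
    thus ?thesis by (rule clifford_representable_mod8) (use 1 assms(2) in auto)
  next
    case 2
    have "k \<noteq> 0"
    proof
      assume "k = 0"
      hence "p = 0 \<and> q = 2 \<or> p = 1 \<and> q = 1 \<or> p = 2 \<and> q = 0" using assms(2) by auto
      thus False using 2 by auto
    qed
    then obtain m where m: "k = Suc m" by (cases k) auto
    have "clifford_representable TYPE(quat) (Suc 0) 3 1"
      using clifford_representable_double[OF clifford_representable_quat, of 1]
      by (simp add: numeral_3_eq_3)
    from clifford_representable_double[OF clifford_representable_swap[OF this], of m]
    have "clifford_representable TYPE(quat) (4 + m) m (Suc m)" by (simp add: eval_nat_numeral)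
    thus ?thesis unfolding m by (rule clifford_representable_mod8) (use 2 assms(2) m in auto)
  qed
qed

section \<open>The isomorphism given by a Clifford system\<close>

text \<open>The real-linear maps on sequences. Only real scalars are required to commute with them,
  since left multiplication by a matrix entry is not linear for left quaternion scalars.\<close>

typedef (overloaded) 'a seq_endo =
  "{f :: (nat \<Rightarrow> 'a::real_algebra_1) \<Rightarrow> nat \<Rightarrow> 'a.
     (\<forall>u v i. f (\<lambda>j. u j + v j) i = f u i + f v i) \<and>
     (\<forall>c u i. f (\<lambda>j. c *\<^sub>R u j) i = c *\<^sub>R f u i)}"
  by (rule exI[of _ id]) simp

setup_lifting type_definition_seq_endo

instantiation seq_endo :: (real_algebra_1) real_algebra_1
begin

lift_definition zero_seq_endo :: "'a seq_endo" is "\<lambda>v i. 0" by simp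
lift_definition one_seq_endo :: "'a seq_endo" is "\<lambda>v. v" by simp
lift_definition plus_seq_endo :: "'a seq_endo \<Rightarrow> 'a seq_endo \<Rightarrow> 'a seq_endo" is
  "\<lambda>f g v i. f v i + g v i" by (simp add: scaleR_add_right)
lift_definition minus_seq_endo :: "'a seq_endo \<Rightarrow> 'a seq_endo \<Rightarrow> 'a seq_endo" is
  "\<lambda>f g v i. f v i - g v i" by (simp add: scaleR_diff_right)
lift_definition uminus_seq_endo :: "'a seq_endo \<Rightarrow> 'a seq_endo" is
  "\<lambda>f v i. - f v i" by simp
lift_definition scaleR_seq_endo :: "real \<Rightarrow> 'a seq_endo \<Rightarrow> 'a seq_endo" is
  "\<lambda>c f v i. c *\<^sub>R f v i" by (simp add: scaleR_add_right scaleR_left_commute)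
lift_definition times_seq_endo :: "'a seq_endo \<Rightarrow> 'a seq_endo \<Rightarrow> 'a seq_endo" is
  "\<lambda>f g v. f (g v)"
proof -
  fix f g :: "(nat \<Rightarrow> 'a) \<Rightarrow> nat \<Rightarrow> 'a"
  assume f: "(\<forall>u v i. f (\<lambda>j. u j + v j) i = f u i + f v i) \<and>
      (\<forall>c u i. f (\<lambda>j. c *\<^sub>R u j) i = c *\<^sub>R f u i)"
    and g: "(\<forall>u v i. g (\<lambda>j. u j + v j) i = g u i + g v i) \<and>
      (\<forall>c u i. g (\<lambda>j. c *\<^sub>R u j) i = c *\<^sub>R g u i)"
  have "g (\<lambda>j. u j + v j) = (\<lambda>i. g u i + g v i)" "g (\<lambda>j. c *\<^sub>R u j) = (\<lambda>i. c *\<^sub>R g u i)" for c u v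
    using g by auto
  thus "(\<forall>u v i. f (g (\<lambda>j. u j + v j)) i = f (g u) i + f (g v) i) \<and>
      (\<forall>c u i. f (g (\<lambda>j. c *\<^sub>R u j)) i = c *\<^sub>R f (g u) i)"
    using f by simp
qed

instance
proof
  have eqI: "f = g" if "\<And>v i. Rep_seq_endo f v i = Rep_seq_endo g v i" for f g :: "'a seq_endo"
    using that by (auto simp flip: Rep_seq_endo_inject)
  have lin: "Rep_seq_endo f (\<lambda>j. u j + v j) i = Rep_seq_endo f u i + Rep_seq_endo f v i"
    "Rep_seq_endo f (\<lambda>j. c *\<^sub>R u j) i = c *\<^sub>R Rep_seq_endo f u i" for f :: "'a seq_endo" and u v i c
    using Rep_seq_endo[of f] by auto
  note rep = zero_seq_endo.rep_eq one_seq_endo.rep_eq plus_seq_endo.rep_eq minus_seq_endo.rep_eq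
    uminus_seq_endo.rep_eq scaleR_seq_endo.rep_eq times_seq_endo.rep_eq
  fix f g h :: "'a seq_endo" and a b :: real
  show "f + g + h = f + (g + h)" "f + g = g + f" "0 + f = f" "- f + f = 0" "f - g = f + - g"
    by (rule eqI; simp add: rep add_ac)+
  show "a *\<^sub>R (f + g) = a *\<^sub>R f + a *\<^sub>R g" "(a + b) *\<^sub>R f = a *\<^sub>R f + b *\<^sub>R f"
    "a *\<^sub>R b *\<^sub>R f = (a * b) *\<^sub>R f" "1 *\<^sub>R f = f"
    by (rule eqI; simp add: rep scaleR_add_right scaleR_add_left)+
  show "f * g * h = f * (g * h)" "1 * f = f" "f * 1 = f" "(f + g) * h = f * h + g * h"
    "f * (g + h) = f * g + f * h" "a *\<^sub>R f * g = a *\<^sub>R (f * g)" "f * a *\<^sub>R g = a *\<^sub>R (f * g)"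
    by (rule eqI; simp add: rep lin)+
  show "(0 :: 'a seq_endo) \<noteq> 1"
  proof transfer
    show "(\<lambda>v i. 0 :: 'a) \<noteq> (\<lambda>v. v)" using fun_cong[of _ _ "\<lambda>_. 1"] by (metis zero_neq_one)
  qed
qed

end

text \<open>The matrix \<open>A\<close> acts on sequences as the block diagonal matrix \<open>A \<oplus> A \<oplus> \<dots>\<close>.
  This puts the matrices of all sizes into one type of algebras, so that the universal property
  of the Clifford algebra applies to them.\<close>

lift_definition mat_endo :: "nat \<Rightarrow> 'a::real_algebra_1 mat \<Rightarrow> 'a seq_endo" is
  "\<lambda>N A v i. \<Sum>j<N. A $$ (i mod N, j) * v (i div N * N + j)"
  by (simp add: distrib_left sum.distrib scaleR_sum_right)

lemma mat_endo_add:
  assumes "A \<in> carrier_mat N N" "B \<in> carrier_mat N N" "N > 0"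
  shows "mat_endo N (A + B) = mat_endo N A + mat_endo N B"
  using assms by transfer (auto simp: fun_eq_iff distrib_right sum.distrib)

lemma mat_endo_scaleR:
  assumes "A \<in> carrier_mat N N" "N > 0"
  shows "mat_endo N (scaleR_mat c A) = c *\<^sub>R mat_endo N A"
  using assms by transfer (auto simp: fun_eq_iff scaleR_sum_right)

text \<open>For \<open>N = 0\<close> all sums would be empty and the map zero, whence
  \<open>N > 0\<close>.\<close>

lemma mat_endo_one:
  assumes "N > 0"
  shows "mat_endo N (1\<^sub>m N) = 1"
  using assms
proof transfer
  fix N :: nat assume N: "N > 0"
  have "(\<Sum>j<N. 1\<^sub>m N $$ (i mod N, j) * v (i div N * N + j)) = v i" for i and v :: "nat \<Rightarrow> 'a"
  proof -
    have "(\<Sum>j<N. 1\<^sub>m N $$ (i mod N, j) * v (i div N * N + j)) =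
      (\<Sum>j<N. if j = i mod N then v (i div N * N + j) else 0)"
      using N by (intro sum.cong) auto
    thus ?thesis using N by simp
  qed
  thus "(\<lambda>v i. \<Sum>j<N. 1\<^sub>m N $$ (i mod N, j) * v (i div N * N + j)) = (\<lambda>v :: nat \<Rightarrow> 'a. v)"
    by blast
qed

lemma mat_endo_mult:
  fixes A B :: "'a::real_algebra_1 mat"
  assumes "A \<in> carrier_mat N N" "B \<in> carrier_mat N N" "N > 0"
  shows "mat_endo N (A * B) = mat_endo N A * mat_endo N B"
  using assms
proof transfer
  fix A B :: "'a mat" and N
  assume AB: "A \<in> carrier_mat N N" "B \<in> carrier_mat N N" "N > 0"
  have "(\<Sum>j<N. (A * B) $$ (i mod N, j) * v (i div N * N + j)) =
    (\<Sum>j<N. A $$ (i mod N, j) * (\<Sum>l<N. B $$ ((i div N * N + j) mod N, l) *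
       v ((i div N * N + j) div N * N + l)))" for i v
  proof -
    have "(\<Sum>j<N. (A * B) $$ (i mod N, j) * v (i div N * N + j)) =
      (\<Sum>j<N. \<Sum>l<N. A $$ (i mod N, l) * B $$ (l, j) * v (i div N * N + j))"
      using AB by (intro sum.cong) (auto simp: scalar_prod_def sum_distrib_right atLeast0LessThan)
    also have "\<dots> = (\<Sum>l<N. \<Sum>j<N. A $$ (i mod N, l) * B $$ (l, j) * v (i div N * N + j))"
      by (rule sum.swap)
    also have "\<dots> = (\<Sum>l<N. A $$ (i mod N, l) * (\<Sum>j<N. B $$ ((i div N * N + l) mod N, j) *
       v ((i div N * N + l) div N * N + j)))"
      by (intro sum.cong) (auto simp: sum_distrib_left mult.assoc)
    finally show ?thesis .
  qed
  thus "(\<lambda>v i. \<Sum>j<N. (A * B) $$ (i mod N, j) * v (i div N * N + j)) =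
    (\<lambda>v i. \<Sum>j<N. A $$ (i mod N, j) * (\<Sum>l<N. B $$ ((i div N * N + j) mod N, l) *
       v ((i div N * N + j) div N * N + l)))" by blast
qed

lemma mat_endo_inj: "inj_on (mat_endo N :: 'a::real_algebra_1 mat \<Rightarrow> _) (carrier_mat N N)"
proof
  fix A B :: "'a mat"
  assume AB: "A \<in> carrier_mat N N" "B \<in> carrier_mat N N" and eq: "mat_endo N A = mat_endo N B"
  show "A = B"
  proof (rule eq_matI)
    fix i l assume "i < dim_row B" "l < dim_col B"
    hence il: "i < N" "l < N" using AB by auto
    have *: "(\<Sum>j<N. C $$ (i, j) * (if j = l then 1 else 0)) = C $$ (i, l)" for C :: "'a mat"
      using il by (simp add: if_distrib[of "\<lambda>x. _ * x"] cong: if_cong)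
    have "(\<Sum>j<N. A $$ (i mod N, j) * v (i div N * N + j)) =
       (\<Sum>j<N. B $$ (i mod N, j) * v (i div N * N + j))" for v
      using fun_cong[OF fun_cong[OF arg_cong[OF eq, of Rep_seq_endo], of v], of i]
      by (simp add: mat_endo.rep_eq)
    \<comment> \<open>The unit sequence at \<open>l\<close>, read at \<open>i\<close> in the first
      block, returns the entry at \<open>(i, l)\<close>.\<close>
    from this[of "\<lambda>j. if j = l then 1 else 0"] show "A $$ (i, l) = B $$ (i, l)"
      using il * by simp
  qed (use AB in auto)
qed

lemma ring_of_type_algebra_ring: "ring (ring_of_type_algebra :: 'a::ring_1 ring)"
proof -
  have "\<exists>y. x + y = 0" "\<exists>y. y + x = 0" for x :: 'a
    using add.right_inverse add.left_inverse by blast+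
  thus ?thesis
    unfolding ring_of_type_algebra_def
    by unfold_locales (auto simp: algebra_simps Units_def)
qed

text \<open>The kernel is an ideal that misses 1, so simplicity makes it zero.\<close>

lemma clifford_hom_inj:
  assumes simple: "simple_ring (clifford p q)"
    and hom: "clifford_hom p q (\<psi> :: _ \<Rightarrow> 'b::real_algebra_1)"
  shows "inj_on \<psi> (carrier (clifford p q))"
proof -
  let ?R = "clifford p q" and ?S = "ring_of_type_algebra :: 'b ring"
  have "ring_hom_ring ?R ?S \<psi>"
    by (rule ring_hom_ringI2[OF clifford_ring ring_of_type_algebra_ring])
      (use hom in \<open>auto simp: Ring.ring_hom_def clifford_hom_def ring_of_type_algebra_def\<close>)
  then interpret h: ring_hom_ring ?R ?S \<psi> .
  have "a_kernel ?R ?S \<psi> = {\<zero>\<^bsub>?R\<^esub>} \<or> a_kernel ?R ?S \<psi> = carrier ?R"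
    using simple h.kernel_is_ideal unfolding simple_ring_def by blast
  moreover have "\<one>\<^bsub>?R\<^esub> \<notin> a_kernel ?R ?S \<psi>"
  proof
    assume "\<one>\<^bsub>?R\<^esub> \<in> a_kernel ?R ?S \<psi>"
    hence "\<psi> \<one>\<^bsub>?R\<^esub> = \<zero>\<^bsub>?S\<^esub>" unfolding a_kernel_def' by blast
    thus False using hom unfolding clifford_hom_def ring_of_type_algebra_def by simp
  qed
  ultimately have "a_kernel ?R ?S \<psi> = {\<zero>\<^bsub>?R\<^esub>}" by auto
  thus ?thesis by (rule h.trivial_ker_imp_inj)
qed

theorem clifford_system_star_iso:
  fixes ps ms :: "'a::star_algebra mat list"
  assumes sys: "clifford_system N ps ms" and len: "length ps = p" "length ms = q"
    and simple: "simple_ring (clifford p q)"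
  shows "\<exists>\<phi>. \<phi> \<in> ring_iso (clifford p q) (ring_mat TYPE('a) N ()) \<and>
    (\<forall>x\<in>carrier (clifford p q). \<phi> (transposition p q x) = adjoint_mat (\<phi> x))"
proof -
  let ?C = "clifford p q" and ?I = "{1..p+q}" and ?M = "carrier_mat N N :: 'a mat set"
  \<comment> \<open>Generators are numbered from 1 and list positions from 0. The first
    \<open>p\<close> entries come from \<open>ps\<close>, in agreement with
    \<open>eps\<close>.\<close>
  define E where "E i = (ps @ ms) ! (i - 1)" for i
  have N: "N > 0" and c: "set (ps @ ms) \<subseteq> ?M" and gen: "?M \<subseteq> mat_algebra N (set (ps @ ms))"
    and anti: "sorted_wrt (\<lambda>x y. x * y = - (y * x)) (ps @ ms)"
    using sys unfolding clifford_system_def by blast+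
  have E_set: "E i \<in> set (ps @ ms)" if "i \<in> ?I" for i
    unfolding E_def by (rule nth_mem) (use that len in auto)
  hence Ec: "E i \<in> ?M" if "i \<in> ?I" for i using that c by blast
  have E_split: "i \<le> p \<and> E i \<in> set ps \<or> \<not> i \<le> p \<and> E i \<in> set ms" if "i \<in> ?I" for i
    using that len by (auto simp: E_def nth_append)
  have E_sq: "E i * E i = scaleR_mat (eps p i) (1\<^sub>m N)" if "i \<in> ?I" for i
  proof -
    have "1\<^sub>m N = scaleR_mat 1 (1\<^sub>m N :: 'a mat)" by (rule eq_matI) auto
    thus ?thesis using E_split[OF that] sys
      by (auto simp: clifford_system_def eps_def uminus_mat_eq_scaleR)
  qed
  have E_adj: "adjoint_mat (E i) = scaleR_mat (eps p i) (E i)" if "i \<in> ?I" for i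
  proof -
    have "E i = scaleR_mat 1 (E i)" by (rule eq_matI) auto
    thus ?thesis using E_split[OF that] sys
      by (auto simp: clifford_system_def eps_def uminus_mat_eq_scaleR)
  qed
  have E_anti: "E i * E j = - (E j * E i)" if "i \<in> ?I" "j \<in> ?I" "i \<noteq> j" for i j
  proof -
    have *: "E i * E j = - (E j * E i)" if "i \<in> ?I" "j \<in> ?I" "i < j" for i j
      using sorted_wrt_nth_less[OF anti, of "i - 1" "j - 1"] that len by (auto simp: E_def)
    show ?thesis using *[of i j] *[of j i] that anticommute_sym[of "E i" "E j"] by linarith
  qed
  define v where "v i = mat_endo N (E i)" for i
  have neg: "mat_endo N (- A) = - mat_endo N A" if "A \<in> ?M" for A :: "'a mat"
    using mat_endo_scaleR[OF that N, of "-1"] by (simp add: uminus_mat_eq_scaleR)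
  have "\<exists>\<psi>. clifford_hom p q \<psi> \<and> (\<forall>i\<in>?I. \<psi> (clifford_gen i) = v i)"
  proof (rule clifford_universal)
    fix i assume i: "i \<in> ?I"
    show "v i * v i = of_real (eps p i)"
      using Ec[OF i] N by (simp add: v_def E_sq[OF i] of_real_def mat_endo_scaleR mat_endo_one
          flip: mat_endo_mult)
  next
    fix i j assume ij: "i \<in> ?I" "j \<in> ?I" "i \<noteq> j"
    have "mat_endo N (E i * E j) = - mat_endo N (E j * E i)"
      using Ec[of i] Ec[of j] ij by (subst E_anti[OF ij]) (simp add: neg)
    thus "v i * v j = - (v j * v i)"
      using Ec[of i] Ec[of j] ij N by (simp add: v_def mat_endo_mult)
  qed
  then obtain \<psi> where \<psi>: "clifford_hom p q \<psi>" "\<forall>i\<in>?I. \<psi> (clifford_gen i) = v i" by blast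
  interpret C: ring ?C by (rule clifford_ring)
  have inj: "inj_on \<psi> (carrier ?C)" by (rule clifford_hom_inj[OF simple \<psi>(1)])
  have \<psi>_one: "\<psi> \<one>\<^bsub>?C\<^esub> = 1"
    and \<psi>_add: "\<And>x y. x \<in> carrier ?C \<Longrightarrow> y \<in> carrier ?C \<Longrightarrow> \<psi> (x \<oplus>\<^bsub>?C\<^esub> y) = \<psi> x + \<psi> y"
    and \<psi>_mult: "\<And>x y. x \<in> carrier ?C \<Longrightarrow> y \<in> carrier ?C \<Longrightarrow> \<psi> (x \<otimes>\<^bsub>?C\<^esub> y) = \<psi> x * \<psi> y"
    and \<psi>_smult: "\<And>c x. x \<in> carrier ?C \<Longrightarrow> \<psi> (c \<odot>\<^bsub>?C\<^esub> x) = c *\<^sub>R \<psi> x"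
    using \<psi>(1) by (auto simp: clifford_hom_def)
  have smult_closed: "c \<odot>\<^bsub>?C\<^esub> x \<in> carrier ?C" if "x \<in> carrier ?C" for c x
    using that by (auto simp: clifford_simps)
  \<comment> \<open>The images of matrices form a subalgebra containing the images of all
    generators, so \<open>\<psi>\<close> stays inside it.\<close>
  have range: "\<psi> x \<in> mat_endo N ` ?M" if "x \<in> carrier ?C" for x
    using that
  proof (induction x rule: clifford_induct)
    case zero
    have "\<psi> (0 \<odot>\<^bsub>?C\<^esub> \<zero>\<^bsub>?C\<^esub>) = 0" by (simp add: \<psi>_smult)
    hence "\<psi> \<zero>\<^bsub>?C\<^esub> = mat_endo N (scaleR_mat 0 (1\<^sub>m N))"
      using N by (simp add: mat_endo_scaleR clifford_simps)
    thus ?case by (rule image_eqI) simp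
  next
    case (add r A x)
    have "finite A" using add(1) finite_subset by blast
    hence "\<psi> (clifford_basis A) \<in> mat_endo N ` ?M" using add(1)
    proof (induction A rule: finite_linorder_min_induct)
      case empty
      have "\<psi> (clifford_basis {}) = mat_endo N (1\<^sub>m N)"
        using \<psi>_one N by (simp add: clifford_simps(3) mat_endo_one)
      thus ?case by (rule image_eqI) simp
    next
      case (insert a A)
      then obtain B where B: "B \<in> ?M" "\<psi> (clifford_basis A) = mat_endo N B" by auto
      have a: "a \<in> ?I" using insert by auto
      have "clifford_basis (insert a A) = clifford_gen a \<otimes>\<^bsub>?C\<^esub> clifford_basis A"
        using insert by (intro clifford_basis_insert) auto
      hence "\<psi> (clifford_basis (insert a A)) = mat_endo N (E a * B)"
        using insert a \<psi>(2) B Ec[OF a] N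
        by (simp add: \<psi>_mult clifford_gen_closed clifford_basis_closed mat_endo_mult v_def)
      thus ?case by (rule image_eqI) (use Ec[OF a] B in simp)
    qed
    then obtain B where B: "B \<in> ?M" "\<psi> (clifford_basis A) = mat_endo N B" by auto
    obtain D where D: "D \<in> ?M" "\<psi> x = mat_endo N D" using add by auto
    have "\<psi> ((r \<odot>\<^bsub>?C\<^esub> clifford_basis A) \<oplus>\<^bsub>?C\<^esub> x) = mat_endo N (scaleR_mat r B + D)"
      using B D N add clifford_basis_closed[OF add(1)]
      by (simp add: \<psi>_add \<psi>_smult smult_closed mat_endo_add mat_endo_scaleR)
    thus ?case by (rule image_eqI) (use B D in simp)
  qed
  \<comment> \<open>Conversely, the image of \<open>\<psi>\<close> is a subalgebra containing the
    given matrices, and these generate everything.\<close>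
  have surj: "mat_endo N A \<in> \<psi> ` carrier ?C" if "A \<in> ?M" for A
  proof -
    have "A \<in> mat_algebra N (set (ps @ ms))" using that gen by blast
    thus ?thesis
    proof induction
      case one
      show ?case using \<psi>_one N by (intro image_eqI[of _ _ "\<one>\<^bsub>?C\<^esub>"]) (auto simp: mat_endo_one)
    next
      case (gen A)
      then obtain i where i: "i < length (ps @ ms)" "(ps @ ms) ! i = A"
        using in_set_conv_nth[of A] by blast
      have "Suc i \<in> ?I" "A = E (Suc i)" using i len by (auto simp: E_def)
      thus ?case using \<psi>(2) clifford_gen_closed[of "Suc i" p q]
        by (intro image_eqI[of _ _ "clifford_gen (Suc i)"]) (auto simp: v_def)
    next
      case (add A B)
      hence AB: "A \<in> ?M" "B \<in> ?M" using mat_algebra_closed[OF c] by auto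
      obtain x y where "x \<in> carrier ?C" "mat_endo N A = \<psi> x" "y \<in> carrier ?C" "mat_endo N B = \<psi> y"
        using add.IH by auto
      thus ?case using AB N
        by (intro image_eqI[of _ _ "x \<oplus>\<^bsub>?C\<^esub> y"]) (auto simp: mat_endo_add \<psi>_add)
    next
      case (mult A B)
      hence AB: "A \<in> ?M" "B \<in> ?M" using mat_algebra_closed[OF c] by auto
      obtain x y where "x \<in> carrier ?C" "mat_endo N A = \<psi> x" "y \<in> carrier ?C" "mat_endo N B = \<psi> y"
        using mult.IH by auto
      thus ?case using AB N
        by (intro image_eqI[of _ _ "x \<otimes>\<^bsub>?C\<^esub> y"]) (auto simp: mat_endo_mult \<psi>_mult)
    next
      case (scaleR A r)
      hence A: "A \<in> ?M" using mat_algebra_closed[OF c] by auto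
      obtain x where "x \<in> carrier ?C" "mat_endo N A = \<psi> x"
        using scaleR.IH by auto
      thus ?case using A N
        by (intro image_eqI[of _ _ "r \<odot>\<^bsub>?C\<^esub> x"]) (auto simp: mat_endo_scaleR \<psi>_smult smult_closed)
    qed
  qed
  \<comment> \<open>Undoing the embedding \<open>mat_endo N\<close> turns \<open>\<psi>\<close> into
    a map with values in matrices.\<close>
  define \<phi> where "\<phi> x = the_inv_into ?M (mat_endo N) (\<psi> x)" for x
  have \<phi>_closed: "\<phi> x \<in> ?M" and \<phi>: "mat_endo N (\<phi> x) = \<psi> x" if "x \<in> carrier ?C" for x
    using range[OF that] mat_endo_inj[of N] unfolding \<phi>_def
    by (auto intro: the_inv_into_into f_the_inv_into_f)
  have \<phi>_eqI: "\<phi> x = A" if "x \<in> carrier ?C" "A \<in> ?M" "\<psi> x = mat_endo N A" for x A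
    using that \<phi> \<phi>_closed mat_endo_inj[of N] by (metis inj_onD)
  have \<phi>_add: "\<phi> (x \<oplus>\<^bsub>?C\<^esub> y) = \<phi> x + \<phi> y" and \<phi>_mult: "\<phi> (x \<otimes>\<^bsub>?C\<^esub> y) = \<phi> x * \<phi> y"
    if "x \<in> carrier ?C" "y \<in> carrier ?C" for x y
    using that \<phi>_closed N
    by (auto intro!: \<phi>_eqI simp: \<psi>_add \<psi>_mult mat_endo_add mat_endo_mult \<phi>)
  have \<phi>_smult: "\<phi> (r \<odot>\<^bsub>?C\<^esub> x) = scaleR_mat r (\<phi> x)" if "x \<in> carrier ?C" for r x
    using that \<phi>_closed N smult_closed
    by (auto intro!: \<phi>_eqI simp: \<psi>_smult mat_endo_scaleR \<phi>)
  have \<phi>_one: "\<phi> \<one>\<^bsub>?C\<^esub> = 1\<^sub>m N" using N by (intro \<phi>_eqI) (auto simp: \<psi>_one mat_endo_one)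
  have \<phi>_gen: "\<phi> (clifford_gen i) = E i" if "i \<in> ?I" for i
    using that \<psi>(2) by (intro \<phi>_eqI Ec clifford_gen_closed) (auto simp: v_def)
  have bij: "bij_betw \<phi> (carrier ?C) ?M"
    unfolding bij_betw_def
  proof
    show "inj_on \<phi> (carrier ?C)" using inj \<phi> by (metis inj_on_def)
    show "\<phi> ` carrier ?C = ?M"
    proof (intro equalityI subsetI)
      fix A assume A: "A \<in> ?M"
      then obtain x where "x \<in> carrier ?C" "mat_endo N A = \<psi> x" using surj by blast
      thus "A \<in> \<phi> ` carrier ?C" using \<phi>_eqI[of x A] A by (metis image_eqI)
    qed (use \<phi>_closed in auto)
  qed
  have iso: "\<phi> \<in> ring_iso ?C (ring_mat TYPE('a) N ())"
    using \<phi>_closed \<phi>_mult \<phi>_add \<phi>_one bij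
    by (intro ring_iso_memI) (auto simp: ring_mat_simps)
  \<comment> \<open>The adjoint carried back to the Clifford algebra. It is an anti-automorphism
    with the prescribed values on generators, so it must be the transposition.\<close>
  define T where "T x = inv_into (carrier ?C) \<phi> (adjoint_mat (\<phi> x))" for x
  have T: "T x \<in> carrier ?C" "\<phi> (T x) = adjoint_mat (\<phi> x)" if "x \<in> carrier ?C" for x
  proof -
    have "adjoint_mat (\<phi> x) \<in> \<phi> ` carrier ?C"
      using bij \<phi>_closed[OF that] by (simp add: bij_betw_def)
    thus "T x \<in> carrier ?C" "\<phi> (T x) = adjoint_mat (\<phi> x)"
      unfolding T_def by (rule inv_into_into, rule f_inv_into_f)
  qed
  have T_eqI: "T x = y" if "x \<in> carrier ?C" "y \<in> carrier ?C" "\<phi> y = adjoint_mat (\<phi> x)" for x y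
    using that T[of x] bij by (metis bij_betw_def inj_onD)
  have "T x = transposition p q x" if "x \<in> carrier ?C" for x
  proof (rule transposition_unique[OF _ _ _ _ _ _ that])
    show "T (x \<oplus>\<^bsub>?C\<^esub> y) = T x \<oplus>\<^bsub>?C\<^esub> T y" if "x \<in> carrier ?C" "y \<in> carrier ?C" for x y
      using that T \<phi>_closed by (intro T_eqI) (auto simp: \<phi>_add adjoint_mat_add[of _ N N])
    show "T (r \<odot>\<^bsub>?C\<^esub> x) = r \<odot>\<^bsub>?C\<^esub> T x" if "x \<in> carrier ?C" for r x
      using that T smult_closed by (intro T_eqI) (auto simp: \<phi>_smult adjoint_mat_scaleR)
    show "T (x \<otimes>\<^bsub>?C\<^esub> y) = T y \<otimes>\<^bsub>?C\<^esub> T x" if "x \<in> carrier ?C" "y \<in> carrier ?C" for x y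
      using that T \<phi>_closed by (intro T_eqI) (auto simp: \<phi>_mult adjoint_mat_mult[of _ N N _ N])
    show "T \<one>\<^bsub>?C\<^esub> = \<one>\<^bsub>?C\<^esub>" by (intro T_eqI) (auto simp: \<phi>_one)
    show "T (clifford_gen i) = eps p i \<odot>\<^bsub>?C\<^esub> clifford_gen i" if "i \<in> ?I" for i
      using that clifford_gen_closed[OF that]
      by (intro T_eqI smult_closed) (auto simp: \<phi>_smult \<phi>_gen E_adj)
  qed (use T in auto)
  hence "\<forall>x\<in>carrier ?C. \<phi> (transposition p q x) = adjoint_mat (\<phi> x)"
    using T(2) by metis
  thus ?thesis using iso by blast
qed

section \<open>The volume element\<close>

text \<open>For each index \<open>b\<close>, one order of multiplication counts the
  \<open>n - b\<close> larger indices, the other the \<open>b - 1\<close> smaller ones. Their sum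
  \<open>n - 1\<close> is even, so the signs agree and the volume element is central.\<close>

lemma clifford_sign_full_commute:
  assumes "A \<subseteq> {1..n}" "odd n"
  shows "clifford_sign p {1..n} A = clifford_sign p A {1..n}"
proof -
  \<comment> \<open>Since \<open>P\<close> fails at \<open>i\<close>, the factor \<open>e\<close>
    occurs exactly once and separates from the signs.\<close>
  have split: "(\<Prod>j\<in>{1..n}. if P j then -1 else if i = j then e else 1) =
      (-1) ^ card {j\<in>{1..n}. P j} * e"
    if "i \<in> {1..n}" "\<not> P i" for P :: "nat \<Rightarrow> bool" and e :: real and i
  proof -
    have "(\<Prod>j\<in>{1..n}. if P j then -1 else if i = j then e else 1) =
      (\<Prod>j\<in>{1..n}. (if P j then -1 else 1) * (if i = j then e else 1))"
      by (rule prod.cong) (use that in auto)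
    also have "\<dots> = (-1) ^ card {j\<in>{1..n}. P j} * e"
      using that(1) by (simp add: prod.distrib prod.If_cases Int_def)
    finally show ?thesis .
  qed
  have "clifford_sign p {1..n} A = (\<Prod>b\<in>A. (-1) ^ card {a\<in>{1..n}. b < a} * eps p b)"
    unfolding clifford_sign_swap
  proof (rule prod.cong[OF refl])
    fix b assume "b \<in> A"
    have "(\<Prod>a\<in>{1..n}. if b < a then -1 else if a = b then eps p a else 1) =
      (\<Prod>a\<in>{1..n}. if b < a then -1 else if b = a then eps p b else 1)"
      by (rule prod.cong) auto
    thus "(\<Prod>a\<in>{1..n}. if b < a then -1 else if a = b then eps p a else 1) =
      (-1) ^ card {a\<in>{1..n}. b < a} * eps p b"
      using split[of b "\<lambda>a. b < a" "eps p b"] \<open>b \<in> A\<close> assms(1) by auto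
  qed
  also have "\<dots> = (\<Prod>a\<in>A. (-1) ^ card {b\<in>{1..n}. b < a} * eps p a)"
  proof (rule prod.cong[OF refl])
    fix b assume "b \<in> A"
    hence b: "b \<in> {1..n}" using assms by auto
    have "{a\<in>{1..n}. b < a} = {b<..n}" "{a\<in>{1..n}. a < b} = {1..<b}" using b by auto
    hence "card {a\<in>{1..n}. b < a} = n - b" "card {a\<in>{1..n}. a < b} = b - 1" by auto
    moreover have "even (n - b) \<longleftrightarrow> even (b - 1)" using b assms(2) by auto
    ultimately show "(-1) ^ card {a\<in>{1..n}. b < a} * eps p b =
        (-1) ^ card {a\<in>{1..n}. a < b} * eps p b"
      by (auto simp: minus_one_power_iff)
  qed
  also have "\<dots> = clifford_sign p A {1..n}"
    unfolding clifford_sign_def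
    by (rule prod.cong[OF refl]) (use split[of _ "\<lambda>b. b < _"] assms(1) in auto)
  finally show ?thesis .
qed

lemma clifford_not_simple:
  assumes "(int p - int q) mod 4 = 1"
  shows "\<not> simple_ring (clifford p q)"
proof
  let ?C = "clifford p q" and ?I = "{1..p+q}"
  assume simple: "simple_ring ?C"
  interpret C: ring ?C by (rule clifford_ring)
  define w where "w = clifford_basis ?I"
  have w: "w \<in> carrier ?C" unfolding w_def by (rule clifford_basis_closed) simp
  have odd: "odd (p + q)" using assms by presburger
  have smult_closed: "c \<odot>\<^bsub>?C\<^esub> x \<in> carrier ?C" if "x \<in> carrier ?C" for c x
    using that by (auto simp: clifford_simps)
  have central: "w \<otimes>\<^bsub>?C\<^esub> x = x \<otimes>\<^bsub>?C\<^esub> w" if "x \<in> carrier ?C" for x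
    using that
  proof (induction x rule: clifford_induct)
    case zero
    show ?case using w by simp
  next
    case (add c A x)
    have sd: "sym_diff ?I A = sym_diff A ?I" by blast
    have A: "clifford_basis A \<in> carrier ?C" using add(1) by (rule clifford_basis_closed)
    have "w \<otimes>\<^bsub>?C\<^esub> clifford_basis A = clifford_basis A \<otimes>\<^bsub>?C\<^esub> w"
      unfolding w_def clifford_basis_mult[OF order_refl add(1)] clifford_basis_mult[OF add(1) order_refl]
      by (simp only: sd clifford_sign_full_commute[OF add(1) odd])
    thus ?case using add w A
      by (simp add: C.r_distr C.l_distr smult_closed clifford_smult_mult)
  qed
  have ww: "w \<otimes>\<^bsub>?C\<^esub> w = \<one>\<^bsub>?C\<^esub>"
  proof -
    let ?n = "p + q"
    \<comment> \<open>The square of \<open>w\<close> is -1 to this power. With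
      \<open>?n = 2 * m + 1\<close> the parity is that of \<open>m + q\<close>, which is even
      because \<open>p - q\<close> is 1 modulo 4.\<close>
    have "even (?n * (?n - 1) div 2 + q)"
    proof -
      obtain m where m: "?n = 2 * m + 1" using odd by (rule oddE)
      have "?n * (?n - 1) div 2 = m * ?n" using m by simp
      moreover have "even (m * ?n) \<longleftrightarrow> even m" using odd by simp
      moreover have "even (m + q)" using m assms by presburger
      ultimately show ?thesis by auto
    qed
    moreover have "(\<Prod>i\<in>?I. eps p i) = (-1) ^ q"
    proof -
      have "?I - {i. i \<le> p} = {p<..p+q}" by auto
      hence "card (?I \<inter> - {i. i \<le> p}) = q" by (simp add: Diff_eq[symmetric])
      thus ?thesis unfolding eps_def by (simp add: prod.If_cases)
    qed
    ultimately have "clifford_sign p ?I ?I = 1"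
      by (simp add: clifford_sign_diagonal flip: power_add)
    thus ?thesis unfolding w_def
      by (subst clifford_basis_mult) (simp_all add: clifford_simps)
  qed
  \<comment> \<open>The eigenspace of \<open>w\<close> for eigenvalue 1 is an ideal as
    \<open>w\<close> is central. It contains \<open>1 + w\<close>, which is nonzero, but not
    1.\<close>
  define J where "J = {x \<in> carrier ?C. w \<otimes>\<^bsub>?C\<^esub> x = x}"
  have "ideal J ?C"
  proof (rule idealI)
    show "subgroup J (add_monoid ?C)"
    proof (rule C.add.subgroupI)
      show "J \<noteq> {}" using w by (auto simp: J_def intro!: exI[of _ "\<zero>\<^bsub>?C\<^esub>"])
    next
      fix x assume "x \<in> J"
      thus "\<ominus>\<^bsub>?C\<^esub> x \<in> J"
        using w by (simp add: J_def C.r_minus)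
    qed (use w in \<open>auto simp: J_def C.r_distr\<close>)
    show "x \<otimes>\<^bsub>?C\<^esub> a \<in> J" if "a \<in> J" "x \<in> carrier ?C" for a x
      using that w central by (simp add: J_def flip: C.m_assoc) (simp add: C.m_assoc)
    show "a \<otimes>\<^bsub>?C\<^esub> x \<in> J" if "a \<in> J" "x \<in> carrier ?C" for a x
      using that w by (simp add: J_def flip: C.m_assoc)
  qed (rule clifford_ring)
  hence "J = {\<zero>\<^bsub>?C\<^esub>} \<or> J = carrier ?C" using simple by (simp add: simple_ring_def)
  moreover have nonempty: "?I \<noteq> {}" using odd by (cases "p + q") auto
  moreover have "\<one>\<^bsub>?C\<^esub> \<oplus>\<^bsub>?C\<^esub> w \<in> J"
    using w ww by (simp add: J_def C.r_distr C.a_comm)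
  moreover have "\<one>\<^bsub>?C\<^esub> \<oplus>\<^bsub>?C\<^esub> w \<noteq> \<zero>\<^bsub>?C\<^esub>"
  proof
    assume "\<one>\<^bsub>?C\<^esub> \<oplus>\<^bsub>?C\<^esub> w = \<zero>\<^bsub>?C\<^esub>"
    \<comment> \<open>Comparison of coefficients at the unit: \<open>w\<close> has coefficient 0
      there, its index set being nonempty.\<close>
    from fun_cong[OF this, of "{}"] nonempty show False
      by (simp add: clifford_simps w_def clifford_basis_def)
  qed
  moreover have "\<one>\<^bsub>?C\<^esub> \<notin> J"
  proof
    assume "\<one>\<^bsub>?C\<^esub> \<in> J"
    hence "w = \<one>\<^bsub>?C\<^esub>" using w by (simp add: J_def)
    from fun_cong[OF this, of "{}"] nonempty show False
      by (simp add: clifford_simps w_def clifford_basis_def)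
  qed
  ultimately show False by auto
qed

section \<open>Corners of matrix rings\<close>

text \<open>The column \<open>u\<close> times the scalar \<open>c\<close> times the row
  \<open>w\<close>. The scalar stands in the middle so that, when \<open>w\<close> times
  \<open>u\<close> is 1, the map from \<open>c\<close> to this matrix is multiplicative over a
  noncommutative ring as well.\<close>

definition outer_mat :: "nat \<Rightarrow> (nat \<Rightarrow> 'a::ring_1) \<Rightarrow> (nat \<Rightarrow> 'a) \<Rightarrow> 'a \<Rightarrow> 'a mat" where
  "outer_mat N u w c = mat N N (\<lambda>(i, j). u i * c * w j)"

lemma outer_mat_carrier [simp]: "outer_mat N u w c \<in> carrier_mat N N"
  by (simp add: outer_mat_def)

lemma outer_mat_mult:
  assumes "(\<Sum>j<N. w j * u j) = 1"
  shows "outer_mat N u w c * outer_mat N u w d = outer_mat N u w (c * d)"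
proof (rule eq_matI)
  fix i j assume "i < dim_row (outer_mat N u w (c * d))" "j < dim_col (outer_mat N u w (c * d))"
  hence ij: "i < N" "j < N" by (simp_all add: outer_mat_def)
  have "(outer_mat N u w c * outer_mat N u w d) $$ (i, j) =
    (\<Sum>l<N. u i * c * w l * (u l * d * w j))"
    using ij by (simp add: outer_mat_def scalar_prod_def atLeast0LessThan)
  also have "\<dots> = u i * c * (\<Sum>l<N. w l * u l) * (d * w j)"
    by (simp add: sum_distrib_left sum_distrib_right mult.assoc)
  finally show "(outer_mat N u w c * outer_mat N u w d) $$ (i, j) = outer_mat N u w (c * d) $$ (i, j)"
    using ij assms by (simp add: outer_mat_def mult.assoc)
qed (simp_all add: outer_mat_def)

text \<open>The row \<open>w\<close>, the matrix \<open>A\<close> and the column \<open>u\<close>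
  multiply to a single scalar; hence sandwiching any matrix again gives an outer product.\<close>

lemma outer_mat_sandwich:
  assumes "A \<in> carrier_mat N N"
  shows "outer_mat N u w c * A * outer_mat N u w d =
    outer_mat N u w (c * (\<Sum>l<N. (\<Sum>k<N. w k * A $$ (k, l)) * u l) * d)"
proof (rule eq_matI)
  let ?s = "\<Sum>l<N. (\<Sum>k<N. w k * A $$ (k, l)) * u l"
  fix i j assume "i < dim_row (outer_mat N u w (c * ?s * d))" "j < dim_col (outer_mat N u w (c * ?s * d))"
  hence ij: "i < N" "j < N" by (simp_all add: outer_mat_def)
  have "(outer_mat N u w c * A * outer_mat N u w d) $$ (i, j) =
    (\<Sum>l<N. (\<Sum>k<N. u i * c * w k * A $$ (k, l)) * (u l * d * w j))"
    using ij assms by (simp add: outer_mat_def scalar_prod_def atLeast0LessThan)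
  also have "\<dots> = u i * c * ?s * (d * w j)"
    by (simp add: sum_distrib_left sum_distrib_right mult.assoc)
  finally show "(outer_mat N u w c * A * outer_mat N u w d) $$ (i, j) =
      outer_mat N u w (c * ?s * d) $$ (i, j)"
    using ij by (simp add: outer_mat_def mult.assoc)
qed (use assms in \<open>simp_all add: outer_mat_def\<close>)

lemma outer_mat_add: "outer_mat N u w (c + d) = outer_mat N u w c + outer_mat N u w d"
  by (rule eq_matI) (auto simp: outer_mat_def algebra_simps)

text \<open>Multiplying by the row \<open>w\<close> on the left and the column \<open>u\<close> on
  the right returns the scalar.\<close>

lemma outer_mat_inj:
  assumes "(\<Sum>j<N. w j * u j) = 1" "outer_mat N u w c = outer_mat N u w d"
  shows "c = d"
proof -
  have *: "(\<Sum>i<N. w i * (\<Sum>j<N. outer_mat N u w c $$ (i, j) * u j)) = c" for c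
  proof -
    have "(\<Sum>i<N. w i * (\<Sum>j<N. outer_mat N u w c $$ (i, j) * u j)) =
      (\<Sum>i<N. w i * u i) * c * (\<Sum>j<N. w j * u j)"
      by (simp add: outer_mat_def sum_distrib_left sum_distrib_right mult.assoc) (rule sum.swap)
    thus ?thesis using assms(1) by simp
  qed
  show ?thesis using *[of c] unfolding assms(2) * by simp
qed

text \<open>At a nonzero entry (a,b) take for \<open>u\<close> column \<open>b\<close> of
  \<open>F\<close> and for \<open>w\<close> row \<open>a\<close>, divided on the left by that entry.
  Since \<open>F * F = F\<close>, the matrix fixes its own columns and rows, and the product of
  \<open>w\<close> and \<open>u\<close> is 1.\<close>

lemma idempotent_mat_outer:
  fixes F :: "'a::division_ring mat"
  assumes F: "F \<in> carrier_mat N N" "F * F = F" "F \<noteq> 0\<^sub>m N N"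
  obtains u w where "(\<Sum>j<N. w j * u j) = 1"
    "F * outer_mat N u w 1 = outer_mat N u w 1" "outer_mat N u w 1 * F = outer_mat N u w 1"
proof -
  have FF: "(\<Sum>l<N. F $$ (i, l) * F $$ (l, j)) = F $$ (i, j)" if "i < N" "j < N" for i j
  proof -
    have "(F * F) $$ (i, j) = (\<Sum>l<N. F $$ (i, l) * F $$ (l, j))"
      using F(1) that by (simp add: scalar_prod_def atLeast0LessThan)
    thus ?thesis using F(2) by simp
  qed
  have "\<exists>i<N. \<exists>j<N. F $$ (i, j) \<noteq> 0"
  proof (rule ccontr)
    assume "\<not> (\<exists>i<N. \<exists>j<N. F $$ (i, j) \<noteq> 0)"
    hence "F = 0\<^sub>m N N" using F(1) by (intro eq_matI) auto
    thus False using F(3) by blast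
  qed
  then obtain a b where ab: "a < N" "b < N" "F $$ (a, b) \<noteq> 0" by blast
  define u where "u i = F $$ (i, b)" for i
  define w where "w j = inverse (F $$ (a, b)) * F $$ (a, j)" for j
  have "(\<Sum>j<N. w j * u j) = inverse (F $$ (a, b)) * (\<Sum>j<N. F $$ (a, j) * F $$ (j, b))"
    by (simp add: u_def w_def sum_distrib_left mult.assoc)
  hence 1: "(\<Sum>j<N. w j * u j) = 1" using FF[OF ab(1,2)] ab(3) by simp
  have "F * outer_mat N u w 1 = outer_mat N u w 1"
  proof (rule eq_matI)
    fix i j assume "i < dim_row (outer_mat N u w 1)" "j < dim_col (outer_mat N u w 1)"
    hence ij: "i < N" "j < N" by (simp_all add: outer_mat_def)
    have "(F * outer_mat N u w 1) $$ (i, j) = (\<Sum>l<N. F $$ (i, l) * F $$ (l, b)) * w j"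
      using ij F(1) by (simp add: outer_mat_def scalar_prod_def atLeast0LessThan u_def
          sum_distrib_right mult.assoc)
    thus "(F * outer_mat N u w 1) $$ (i, j) = outer_mat N u w 1 $$ (i, j)"
      using ij FF[OF ij(1) ab(2)] by (simp add: outer_mat_def u_def)
  qed (use F(1) in \<open>simp_all add: outer_mat_def\<close>)
  moreover have "outer_mat N u w 1 * F = outer_mat N u w 1"
  proof (rule eq_matI)
    fix i j assume "i < dim_row (outer_mat N u w 1)" "j < dim_col (outer_mat N u w 1)"
    hence ij: "i < N" "j < N" by (simp_all add: outer_mat_def)
    have "(outer_mat N u w 1 * F) $$ (i, j) =
        u i * (inverse (F $$ (a, b)) * (\<Sum>l<N. F $$ (a, l) * F $$ (l, j)))"
      using ij F(1) by (simp add: outer_mat_def scalar_prod_def atLeast0LessThan w_def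
          sum_distrib_left mult.assoc)
    thus "(outer_mat N u w 1 * F) $$ (i, j) = outer_mat N u w 1 $$ (i, j)"
      using ij FF[OF ab(1) ij(2)] by (simp add: outer_mat_def w_def)
  qed (use F(1) in \<open>simp_all add: outer_mat_def\<close>)
  ultimately show thesis using 1 that by blast
qed

text \<open>An idempotent of rank one lies under the image of \<open>f\<close>, and primitivity
  makes the two equal. The corner then consists of the outer products with the fixed
  \<open>u\<close>, \<open>w\<close>, indexed by the division ring.\<close>

lemma corner_ring_mat_division:
  fixes \<phi> :: "'b \<Rightarrow> 'a::division_ring mat"
  assumes ring: "ring R" and iso: "\<phi> \<in> ring_iso R (ring_mat TYPE('a) N ())"
    and prim: "primitive_idempotent R f"
  shows "(ring_of_type_algebra :: 'a ring) \<simeq> corner_ring R f"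
proof -
  interpret R: ring R by (rule ring)
  have \<phi>_closed: "\<And>x. x \<in> carrier R \<Longrightarrow> \<phi> x \<in> carrier_mat N N"
    and \<phi>_mult: "\<And>x y. x \<in> carrier R \<Longrightarrow> y \<in> carrier R \<Longrightarrow> \<phi> (x \<otimes>\<^bsub>R\<^esub> y) = \<phi> x * \<phi> y"
    and \<phi>_add: "\<And>x y. x \<in> carrier R \<Longrightarrow> y \<in> carrier R \<Longrightarrow> \<phi> (x \<oplus>\<^bsub>R\<^esub> y) = \<phi> x + \<phi> y"
    and bij: "bij_betw \<phi> (carrier R) (carrier_mat N N)"
    using iso by (auto simp: ring_iso_def Ring.ring_hom_def ring_mat_simps)
  have inj: "x = y" if "x \<in> carrier R" "y \<in> carrier R" "\<phi> x = \<phi> y" for x y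
    using bij that by (auto simp: bij_betw_def inj_on_def)
  define \<psi> where "\<psi> = inv_into (carrier R) \<phi>"
  have \<psi>: "\<psi> A \<in> carrier R" "\<phi> (\<psi> A) = A" if "A \<in> carrier_mat N N" for A
    using that bij unfolding \<psi>_def bij_betw_def
    by (auto intro: inv_into_into f_inv_into_f)
  have \<phi>_zero: "\<phi> \<zero>\<^bsub>R\<^esub> = 0\<^sub>m N N"
  proof -
    have c: "\<phi> \<zero>\<^bsub>R\<^esub> \<in> carrier_mat N N" by (simp add: \<phi>_closed)
    have "\<phi> \<zero>\<^bsub>R\<^esub> = \<phi> \<zero>\<^bsub>R\<^esub> + \<phi> \<zero>\<^bsub>R\<^esub>" using \<phi>_add[of "\<zero>\<^bsub>R\<^esub>" "\<zero>\<^bsub>R\<^esub>"] by simp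
    hence "\<phi> \<zero>\<^bsub>R\<^esub> $$ (i, j) = \<phi> \<zero>\<^bsub>R\<^esub> $$ (i, j) + \<phi> \<zero>\<^bsub>R\<^esub> $$ (i, j)" if "i < N" "j < N" for i j
      using c that by (metis index_add_mat(1) carrier_matD)
    thus ?thesis using c by (intro eq_matI) auto
  qed
  have f: "f \<in> carrier R" "f \<otimes>\<^bsub>R\<^esub> f = f" "f \<noteq> \<zero>\<^bsub>R\<^esub>"
    using prim by (auto simp: primitive_idempotent_def idempotent_element_def)
  have "\<phi> f \<noteq> 0\<^sub>m N N" using inj[of f "\<zero>\<^bsub>R\<^esub>"] f \<phi>_zero by auto
  moreover have "\<phi> f * \<phi> f = \<phi> f" using \<phi>_mult[of f f] f by simp
  ultimately obtain u w where uw: "(\<Sum>j<N. w j * u j) = 1"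
    "\<phi> f * outer_mat N u w 1 = outer_mat N u w 1" "outer_mat N u w 1 * \<phi> f = outer_mat N u w 1"
    using idempotent_mat_outer \<phi>_closed[OF f(1)] by metis
  define m where "m = outer_mat N u w"
  have m: "m c \<in> carrier_mat N N" "m c * m d = m (c * d)" "m (c + d) = m c + m d" for c d
    unfolding m_def by (simp_all add: outer_mat_mult[OF uw(1)] outer_mat_add)
  have m_inj: "c = d" if "m c = m d" for c d
    using outer_mat_inj[OF uw(1)] that unfolding m_def by blast
  define g where "g = \<psi> (m 1)"
  have g: "g \<in> carrier R" "\<phi> g = m 1" unfolding g_def using \<psi> m by auto
  have gg: "g \<otimes>\<^bsub>R\<^esub> g = g" "f \<otimes>\<^bsub>R\<^esub> g = g" "g \<otimes>\<^bsub>R\<^esub> f = g"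
    using f(1) g uw m by (auto intro!: inj simp: \<phi>_mult m_def)
  have "f = g"
  proof -
    \<comment> \<open>The complement \<open>h\<close> of \<open>g\<close> in \<open>f\<close> is an
      idempotent orthogonal to \<open>g\<close>, so primitivity of \<open>f\<close> forces it to
      vanish.\<close>
    define h where "h = f \<ominus>\<^bsub>R\<^esub> g"
    have h: "h \<in> carrier R" using f g by (simp add: h_def)
    have gh: "g \<otimes>\<^bsub>R\<^esub> h = \<zero>\<^bsub>R\<^esub>" "h \<otimes>\<^bsub>R\<^esub> g = \<zero>\<^bsub>R\<^esub>"
      using f g gg by (simp_all add: h_def a_minus_def R.r_distr R.l_distr R.r_minus R.l_minus R.r_neg)
    have fh: "f = g \<oplus>\<^bsub>R\<^esub> h"
      using f g unfolding h_def a_minus_def by (metis R.a_comm R.a_assoc R.a_inv_closed R.l_neg R.r_zero)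
    have "h \<otimes>\<^bsub>R\<^esub> h = f \<otimes>\<^bsub>R\<^esub> h"
      using arg_cong[OF fh, of "\<lambda>x. x \<otimes>\<^bsub>R\<^esub> h"] f g h gh by (simp add: R.l_distr)
    also have "\<dots> = h"
      using f g gg by (simp add: h_def a_minus_def R.r_distr R.r_minus)
    finally have "idempotent_element R h" using h by (simp add: idempotent_element_def)
    moreover have "idempotent_element R g" using g gg by (simp add: idempotent_element_def)
    moreover have "g \<noteq> \<zero>\<^bsub>R\<^esub>"
    proof
      assume "g = \<zero>\<^bsub>R\<^esub>"
      moreover have "m 0 = 0\<^sub>m N N" by (rule eq_matI) (simp_all add: m_def outer_mat_def)
      ultimately have "m 1 = m 0" using g(2) \<phi>_zero by simp
      thus False using m_inj[of 1 0] by simp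
    qed
    ultimately have "h = \<zero>\<^bsub>R\<^esub>" using prim gh fh unfolding primitive_idempotent_def by blast
    thus ?thesis using fh g by simp
  qed
  hence \<phi>f: "\<phi> f = m 1" using g by simp
  define \<kappa> where "\<kappa> c = \<psi> (m c)" for c
  have \<kappa>: "\<kappa> c \<in> carrier R" "\<phi> (\<kappa> c) = m c" for c
    unfolding \<kappa>_def using \<psi> m by auto
  have sandwich: "f \<otimes>\<^bsub>R\<^esub> x \<otimes>\<^bsub>R\<^esub> f \<in> range \<kappa>" if x: "x \<in> carrier R" for x
  proof -
    obtain s where s: "m 1 * \<phi> x * m 1 = m s"
      unfolding m_def using outer_mat_sandwich[OF \<phi>_closed[OF x], of u w 1 1] by blast
    have "\<phi> (f \<otimes>\<^bsub>R\<^esub> x \<otimes>\<^bsub>R\<^esub> f) = m 1 * \<phi> x * m 1"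
      using f that by (simp only: \<phi>_mult R.m_closed \<phi>f)
    hence "f \<otimes>\<^bsub>R\<^esub> x \<otimes>\<^bsub>R\<^esub> f = \<kappa> s" using f that s \<kappa> by (intro inj) auto
    thus ?thesis by blast
  qed
  have corner_id: "f \<otimes>\<^bsub>R\<^esub> \<kappa> c \<otimes>\<^bsub>R\<^esub> f = \<kappa> c" for c
    using f \<kappa> m by (intro inj) (auto simp: \<phi>_mult \<phi>f)
  have "\<kappa> \<in> ring_iso (ring_of_type_algebra :: 'a ring) (corner_ring R f)"
  proof (rule ring_iso_memI)
    show "\<kappa> c \<in> carrier (corner_ring R f)" for c
      using corner_id[of c] \<kappa>(1)[of c] by (auto simp: corner_ring_def intro!: exI[of _ "\<kappa> c"])
    show "\<kappa> (c \<otimes>\<^bsub>ring_of_type_algebra\<^esub> d) = \<kappa> c \<otimes>\<^bsub>corner_ring R f\<^esub> \<kappa> d" for c d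
      using \<kappa> m by (auto simp: corner_ring_def ring_of_type_algebra_def \<phi>_mult intro!: inj)
    show "\<kappa> (c \<oplus>\<^bsub>ring_of_type_algebra\<^esub> d) = \<kappa> c \<oplus>\<^bsub>corner_ring R f\<^esub> \<kappa> d" for c d
      using \<kappa> m by (auto simp: corner_ring_def ring_of_type_algebra_def \<phi>_add intro!: inj)
    show "\<kappa> \<one>\<^bsub>ring_of_type_algebra\<^esub> = \<one>\<^bsub>corner_ring R f\<^esub>"
      using \<kappa> f \<phi>f by (auto simp: corner_ring_def ring_of_type_algebra_def intro!: inj)
    show "bij_betw \<kappa> (carrier ring_of_type_algebra) (carrier (corner_ring R f))"
      unfolding bij_betw_def
    proof
      show "inj_on \<kappa> (carrier ring_of_type_algebra)"
        by (rule inj_onI) (metis m_inj \<kappa>(2))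
      show "\<kappa> ` carrier ring_of_type_algebra = carrier (corner_ring R f)"
      proof (intro equalityI subsetI)
        fix x assume "x \<in> \<kappa> ` carrier ring_of_type_algebra"
        then obtain c where "x = \<kappa> c" by blast
        hence "x = f \<otimes>\<^bsub>R\<^esub> \<kappa> c \<otimes>\<^bsub>R\<^esub> f" by (simp only: corner_id)
        thus "x \<in> carrier (corner_ring R f)" using \<kappa>(1) by (auto simp: corner_ring_def)
      next
        fix x assume "x \<in> carrier (corner_ring R f)"
        then obtain y where "y \<in> carrier R" "x = f \<otimes>\<^bsub>R\<^esub> y \<otimes>\<^bsub>R\<^esub> f"
          by (auto simp: corner_ring_def)
        thus "x \<in> \<kappa> ` carrier ring_of_type_algebra"
          using sandwich by (simp add: ring_of_type_algebra_def)
      qed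
    qed
  qed
  thus ?thesis unfolding is_ring_iso_def by blast
qed

section \<open>Telling the three division rings apart\<close>

lemma ring_of_type_algebra_iso_invariants:
  assumes "(ring_of_type_algebra :: 'a::ring_1 ring) \<simeq> (ring_of_type_algebra :: 'b::ring_1 ring)"
  shows "(\<exists>x :: 'a. x * x + 1 = 0) \<longleftrightarrow> (\<exists>x :: 'b. x * x + 1 = 0)"
    and "(\<forall>x y :: 'a. x * y = y * x) \<longleftrightarrow> (\<forall>x y :: 'b. x * y = y * x)"
proof -
  obtain h :: "'a \<Rightarrow> 'b" where h: "bij h"
    and hom: "\<And>x y. h (x * y) = h x * h y" "\<And>x y. h (x + y) = h x + h y" "h 1 = 1"
    using assms by (auto simp: is_ring_iso_def ring_iso_def Ring.ring_hom_def ring_of_type_algebra_def)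
  have "h 0 = 0" using hom(2)[of 0 0] by simp
  hence eq0: "h x = 0 \<longleftrightarrow> x = 0" for x using h by (metis bij_def injD)
  have "x * x + 1 = 0 \<longleftrightarrow> h x * h x + 1 = 0" for x using eq0[of "x * x + 1"] hom by simp
  thus "(\<exists>x :: 'a. x * x + 1 = 0) \<longleftrightarrow> (\<exists>x :: 'b. x * x + 1 = 0)"
    using h by (metis bij_def surjD)
  have "x * y = y * x \<longleftrightarrow> h x * h y = h y * h x" for x y
    using h hom(1) by (metis bij_def injD)
  thus "(\<forall>x y :: 'a. x * y = y * x) \<longleftrightarrow> (\<forall>x y :: 'b. x * y = y * x)"
    using h by (metis bij_def surjD)
qed

text \<open>A root of \<open>x * x + 1\<close> separates the complex numbers from the reals;
  noncommutativity separates the quaternions from both.\<close>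

lemma real_complex_quat_ring_iso:
  "\<not> real_ring \<simeq> complex_ring" "\<not> complex_ring \<simeq> real_ring"
  "\<not> real_ring \<simeq> quat_ring" "\<not> quat_ring \<simeq> real_ring"
  "\<not> complex_ring \<simeq> quat_ring" "\<not> quat_ring \<simeq> complex_ring"
proof -
  have "x * x + 1 \<noteq> 0" for x :: real using zero_le_square[of x] by linarith
  hence real: "\<not> (\<exists>x :: real. x * x + 1 = 0)" by blast
  have complex: "\<exists>x :: complex. x * x + 1 = 0" by (rule exI[of _ \<i>]) simp
  have "Quat 0 1 0 0 * Quat 0 0 1 0 \<noteq> Quat 0 0 1 0 * Quat 0 1 0 0"
    by (simp add: quat_eq_iff)
  hence quat: "\<not> (\<forall>x y :: quat. x * y = y * x)" by blast
  have comm: "\<forall>x y :: real. x * y = y * x" "\<forall>x y :: complex. x * y = y * x"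
    by (simp_all add: mult.commute)
  note inv = ring_of_type_algebra_iso_invariants
  show "\<not> real_ring \<simeq> complex_ring" "\<not> complex_ring \<simeq> real_ring"
    "\<not> real_ring \<simeq> quat_ring" "\<not> quat_ring \<simeq> real_ring"
    "\<not> complex_ring \<simeq> quat_ring" "\<not> quat_ring \<simeq> complex_ring"
    unfolding real_ring_def complex_ring_def quat_ring_def
    using real complex quat comm inv(1)[where 'a = real and 'b = complex]
      inv(1)[where 'a = complex and 'b = real] inv(2)[where 'a = real and 'b = quat]
      inv(2)[where 'a = quat and 'b = real] inv(2)[where 'a = complex and 'b = quat]
      inv(2)[where 'a = quat and 'b = complex]
    by blast+
qed

lemma ring_iso_iff_of_iso:
  assumes "ring R" "R \<simeq> S"
  shows "S \<simeq> T \<longleftrightarrow> R \<simeq> T"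
  using ring_iso_trans[of S R T] ring_iso_trans[of R S T] ring_iso_sym[OF assms] assms(2) by blast

section \<open>The transposition group\<close>

definition unitary_mat_group :: "'a::star_algebra itself \<Rightarrow> nat \<Rightarrow> 'a mat monoid" where
  "unitary_mat_group _ N =
     \<lparr> carrier = {A \<in> carrier_mat N N. adjoint_mat A * A = 1\<^sub>m N},
       monoid.mult = (*), one = 1\<^sub>m N \<rparr>"

lemma unitary_mat_group_eqs:
  "unitary_mat_group TYPE(real) N = orthogonal_group N"
  "unitary_mat_group TYPE(complex) N = unitary_group N"
  "unitary_mat_group TYPE(quat) N = symplectic_group N"
proof -
  have "map_mat cj A = A" for A :: "real mat"
    by (rule eq_matI) (auto simp: cj_real_def)
  thus "unitary_mat_group TYPE(real) N = orthogonal_group N"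
    "unitary_mat_group TYPE(complex) N = unitary_group N"
    "unitary_mat_group TYPE(quat) N = symplectic_group N"
    by (simp_all add: unitary_mat_group_def orthogonal_group_def unitary_group_def
        symplectic_group_def adjoint_mat_def cj_complex_def cj_quat_def)
qed

text \<open>The ring isomorphism sends the transposition to the adjoint, so it carries one defining
  equation into the other. The same isomorphism determines the corner rings.\<close>

lemma transposition_group_iso:
  assumes "clifford_representable TYPE('a::star_algebra) p q k" "simple_ring (clifford p q)"
  shows "transposition_group p q \<cong> unitary_mat_group TYPE('a) (2 ^ k)"
    and "primitive_idempotent (clifford p q) f \<Longrightarrow>
      (ring_of_type_algebra :: 'a ring) \<simeq> corner_ring (clifford p q) f"
proof -
  let ?C = "clifford p q" and ?N = "2 ^ k :: nat"
  obtain \<phi> where iso: "\<phi> \<in> ring_iso ?C (ring_mat TYPE('a) ?N ())"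
    and star: "\<And>x. x \<in> carrier ?C \<Longrightarrow> \<phi> (transposition p q x) = adjoint_mat (\<phi> x)"
    using assms clifford_system_star_iso unfolding clifford_representable_def by metis
  show "(ring_of_type_algebra :: 'a ring) \<simeq> corner_ring ?C f" if "primitive_idempotent ?C f"
    by (rule corner_ring_mat_division[OF clifford_ring iso that])
  have mult: "\<And>x y. x \<in> carrier ?C \<Longrightarrow> y \<in> carrier ?C \<Longrightarrow> \<phi> (x \<otimes>\<^bsub>?C\<^esub> y) = \<phi> x * \<phi> y"
    and one: "\<phi> \<one>\<^bsub>?C\<^esub> = 1\<^sub>m ?N" and bij: "bij_betw \<phi> (carrier ?C) (carrier_mat ?N ?N)"
    using iso by (auto simp: ring_iso_def Ring.ring_hom_def ring_mat_simps)
  interpret C: ring ?C by (rule clifford_ring)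
  have iff: "transposition p q g \<otimes>\<^bsub>?C\<^esub> g = \<one>\<^bsub>?C\<^esub> \<longleftrightarrow> adjoint_mat (\<phi> g) * \<phi> g = 1\<^sub>m ?N"
    if "g \<in> carrier ?C" for g
  proof -
    have t: "transposition p q g \<in> carrier ?C" using that by (rule transposition_anti_involution(1)[OF _ that])
    have "transposition p q g \<otimes>\<^bsub>?C\<^esub> g = \<one>\<^bsub>?C\<^esub> \<longleftrightarrow>
        \<phi> (transposition p q g \<otimes>\<^bsub>?C\<^esub> g) = \<phi> \<one>\<^bsub>?C\<^esub>"
      using bij t that by (metis C.m_closed C.one_closed bij_betw_def inj_onD)
    thus ?thesis using t that by (simp add: mult star one)
  qed
  have "\<phi> \<in> iso (transposition_group p q) (unitary_mat_group TYPE('a) ?N)"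
  proof (rule isoI)
    show "\<phi> \<in> hom (transposition_group p q) (unitary_mat_group TYPE('a) ?N)"
      using bij iff mult
      by (auto simp: hom_def transposition_group_def unitary_mat_group_def bij_betw_def)
    show "bij_betw \<phi> (carrier (transposition_group p q)) (carrier (unitary_mat_group TYPE('a) ?N))"
      unfolding bij_betw_def
    proof
      show "inj_on \<phi> (carrier (transposition_group p q))"
        using bij by (auto simp: bij_betw_def transposition_group_def intro: inj_on_subset)
      show "\<phi> ` carrier (transposition_group p q) = carrier (unitary_mat_group TYPE('a) ?N)"
      proof (intro equalityI subsetI)
        fix A assume A: "A \<in> carrier (unitary_mat_group TYPE('a) ?N)"
        then obtain g where "g \<in> carrier ?C" "A = \<phi> g"
          using bij by (auto simp: bij_betw_def unitary_mat_group_def)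
        thus "A \<in> \<phi> ` carrier (transposition_group p q)"
          using A iff by (auto simp: transposition_group_def unitary_mat_group_def)
      qed (use bij iff in \<open>auto simp: transposition_group_def unitary_mat_group_def bij_betw_def\<close>)
    qed
  qed
  thus "transposition_group p q \<cong> unitary_mat_group TYPE('a) ?N" by (rule is_isoI)
qed

text \<open>The dimension count: \<open>2 ^ (p + q)\<close> is \<open>N\<close> squared times the
  real dimension 1, 2 or 4 of the division ring, with \<open>N = 2 ^ k\<close>.\<close>

lemma radon_hurwitz_dimension:
  assumes "int k = int q - radon_hurwitz (int q - int p)"
  shows "(int p - int q) mod 8 \<in> {0, 2} \<Longrightarrow> p + q = 2 * k"
    and "(int p - int q) mod 8 \<in> {3, 7} \<Longrightarrow> p + q = 2 * k + 1"
    and "(int p - int q) mod 8 \<in> {4, 6} \<Longrightarrow> p + q = 2 * k + 2"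
proof -
  define d where "d = int q - int p"
  define t where "t = d div 8"
  have r: "int k = int q - radon_hurwitz d" using assms by (simp add: d_def)
  have eq: "d = 8 * t + d mod 8" "(int p - int q) mod 8 = (- d) mod 8" by (simp_all add: t_def d_def)
  have p: "int p = int q - d" by (simp add: d_def)
  show "p + q = 2 * k" if "(int p - int q) mod 8 \<in> {0, 2}"
  proof -
    have "(- d) mod 8 = 0 \<or> (- d) mod 8 = 2" using that eq(2) by simp
    \<comment> \<open>The Radon-Hurwitz number is taken at \<open>q - p\<close>, so residues of
      \<open>p - q\<close> are negated.\<close>
    hence "d mod 8 = 0 \<or> d mod 8 = 6" by presburger
    thus ?thesis using r p eq(1)
      by (auto simp: radon_hurwitz_def eval_nat_numeral simp flip: t_def)
  qed
  show "p + q = 2 * k + 1" if "(int p - int q) mod 8 \<in> {3, 7}"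
  proof -
    have "(- d) mod 8 = 3 \<or> (- d) mod 8 = 7" using that eq(2) by simp
    hence "d mod 8 = 5 \<or> d mod 8 = 1" by presburger
    thus ?thesis using r p eq(1)
      by (auto simp: radon_hurwitz_def eval_nat_numeral simp flip: t_def)
  qed
  show "p + q = 2 * k + 2" if "(int p - int q) mod 8 \<in> {4, 6}"
  proof -
    have "(- d) mod 8 = 4 \<or> (- d) mod 8 = 6" using that eq(2) by simp
    hence "d mod 8 = 4 \<or> d mod 8 = 2" by presburger
    thus ?thesis using r p eq(1)
      by (auto simp: radon_hurwitz_def eval_nat_numeral simp flip: t_def)
  qed
qed

theorem proposition5:
  fixes p q k N :: nat
  assumes simple: "simple_ring (clifford p q)"
    and k: "int k = int q - radon_hurwitz (int q - int p)"
    and N: "N = 2 ^ k"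
  shows
    "(\<forall>f. primitive_idempotent (clifford p q) f \<longrightarrow>
        (corner_ring (clifford p q) f \<simeq> real_ring \<longrightarrow>
           transposition_group p q \<cong> orthogonal_group N) \<and>
        (corner_ring (clifford p q) f \<simeq> complex_ring \<longrightarrow>
           transposition_group p q \<cong> unitary_group N) \<and>
        (corner_ring (clifford p q) f \<simeq> quat_ring \<longrightarrow>
           transposition_group p q \<cong> symplectic_group N) \<and>
        (corner_ring (clifford p q) f \<simeq> real_ring \<longleftrightarrow>
           (int p - int q) mod 8 \<in> {0, 1, 2}) \<and>
        (corner_ring (clifford p q) f \<simeq> complex_ring \<longleftrightarrow>
           (int p - int q) mod 8 \<in> {3, 7}) \<and>
        (corner_ring (clifford p q) f \<simeq> quat_ring \<longleftrightarrow>
           (int p - int q) mod 8 \<in> {4, 5, 6})) \<and>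
     ((int p - int q) mod 8 \<in> {0, 1, 2} \<longrightarrow>
        transposition_group p q \<cong> orthogonal_group N) \<and>
     ((int p - int q) mod 8 \<in> {3, 7} \<longrightarrow>
        transposition_group p q \<cong> unitary_group N) \<and>
     ((int p - int q) mod 8 \<in> {4, 5, 6} \<longrightarrow>
        transposition_group p q \<cong> symplectic_group N)"
proof -
  let ?C = "clifford p q" and ?d = "(int p - int q) mod 8"
  \<comment> \<open>A residue 1 or 5 modulo 8 is 1 modulo 4, which contradicts simplicity.\<close>
  have "?d mod 4 \<noteq> 1"
    using clifford_not_simple[of p q] simple by (auto simp: mod_mod_cancel)
  moreover have "?d \<in> {0, 1, 2, 3, 4, 5, 6, 7}" by auto
  ultimately consider "?d \<in> {0, 2}" | "?d \<in> {3, 7}" | "?d \<in> {4, 6}" by auto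
  thus ?thesis
  proof cases
    case 1
    note rep = clifford_representable_realI[OF 1 radon_hurwitz_dimension(1)[OF k 1]]
    note group = transposition_group_iso(1)[OF rep simple, folded N, unfolded unitary_mat_group_eqs]
    \<comment> \<open>Every corner is a copy of the reals here, so each corner condition becomes a
      comparison of two of the three standard rings.\<close>
    have corner: "corner_ring ?C f \<simeq> T \<longleftrightarrow> real_ring \<simeq> T"
      if "primitive_idempotent ?C f" for f and T :: "'t ring"
      using ring_iso_iff_of_iso[OF ring_of_type_algebra_ring transposition_group_iso(2)[OF rep simple that]]
      unfolding real_ring_def .
    show ?thesis using 1 group by (auto simp: corner real_complex_quat_ring_iso ring_iso_refl)
  next
    case 2
    note rep = clifford_representable_complexI[OF 2 radon_hurwitz_dimension(2)[OF k 2]]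
    note group = transposition_group_iso(1)[OF rep simple, folded N, unfolded unitary_mat_group_eqs]
    have corner: "corner_ring ?C f \<simeq> T \<longleftrightarrow> complex_ring \<simeq> T"
      if "primitive_idempotent ?C f" for f and T :: "'t ring"
      using ring_iso_iff_of_iso[OF ring_of_type_algebra_ring transposition_group_iso(2)[OF rep simple that]]
      unfolding complex_ring_def .
    show ?thesis using 2 group by (auto simp: corner real_complex_quat_ring_iso ring_iso_refl)
  next
    case 3
    note rep = clifford_representable_quatI[OF 3 radon_hurwitz_dimension(3)[OF k 3]]
    note group = transposition_group_iso(1)[OF rep simple, folded N, unfolded unitary_mat_group_eqs]
    have corner: "corner_ring ?C f \<simeq> T \<longleftrightarrow> quat_ring \<simeq> T"
      if "primitive_idempotent ?C f" for f and T :: "'t ring"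
      using ring_iso_iff_of_iso[OF ring_of_type_algebra_ring transposition_group_iso(2)[OF rep simple that]]
      unfolding quat_ring_def .
    show ?thesis using 3 group by (auto simp: corner real_complex_quat_ring_iso ring_iso_refl)
  qed
qed

end
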